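(* Let $m=x_{i_1}\cdots x_{i_s}$ be a square-free monomial in $S=\mathbb{K}[x_1,\ldots,x_n]$ (with $s\ge 1$ and $i_1<\cdots<i_s\le n$), with $T(m) = (t_0,t_1,\ldots,t_k)$ and $IT(m) = (i_{t_0},i_{t_1},\ldots,i_{t_k})$, and let $I = {\rm sfBorel}(m)$. Suppose that $\ell\in\{0,\ldots,k-1\}$ is the smallest integer such that $i_{t_{\ell+1}} < t_0 \leq i_{t_\ell}$. Define $\nu=i_{t_{\ell+1}}+1$. Then $$\widehat{\alpha}(I) \geq \widehat{\alpha}\bigl({\rm sfBorel}(x_{i_1}x_{i_2}\cdots x_{i_{t_{\ell+1}}})\bigr)+1 + \frac{t_0-\nu}{i_{\nu}-\nu+1},$$ where $i_\nu$ denotes the $\nu$-th index in $i_1<\cdots<i_s$ (note $\nu\le t_0=s$).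
   Context: $\mathbb{K}$ is a field of characteristic zero and $S=\mathbb{K}[x_1,\ldots,x_n]$. Borel moves: for a monomial $m$, if $x_i \mid m$ and $j<i$, then $x_j\cdot\frac{m}{x_i}$ is called a Borel move of $m$. For a square-free monomial $m\in S$, ${\rm sfBorel}(m)\subseteq S$ is the square-free monomial ideal generated by all square-free monomials that can be obtained from $m$ by a (possibly empty) sequence of Borel moves. The tuples $T(m)$, $IT(m)$: for $m=x_{i_1}\cdots x_{i_s}$ with $i_1<\cdots<i_s$, put $t_0=s$ and, recursively, $t_p=\max\{j<t_{p-1} \mid i_j<i_{j+1}-1\}$ as long as this set is non-empty; $T(m)=(t_0,t_1,\ldots,t_k)$ is the resulting tuple, where $t_k$ is the last term defined. Then $IT(m)=(i_{t_0},i_{t_1},\ldots,i_{t_k})$. The monomial $x_{i_1}x_{i_2}\cdots x_{i_{t_{\ell+1}}}$ is the product of the first $t_{\ell+1}$ variables of $m$. Waldschmidt constant: for a square-free monomial ideal $I$ with minimal primary decomposition $I=P_1\cap\cdots\cap P_r$, the $q$-th symbolic power is $I^{(q)}=P_1^q\cap\cdots\cap P_r^q$. For a homogeneous ideal $J$, $\alpha(J)$ denotes the smallest degree of a generator of $J$. The Waldschmidt constant of $I$ is $\widehat{\alpha}(I)=\lim_{q\to\infty}\alpha(I^{(q)})/q$. *)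

theory Defs
  imports
    Complex_Main
    "HOL-Library.Poly_Mapping"
    "HOL-Algebra.Ideal_Product"
begin

text \<open>
  A monomial is identified with its exponent vector, of type \<^typ>\<open>nat \<Rightarrow>\<^sub>0 nat\<close>, and a
  polynomial with its coefficient function, of type \<^typ>\<open>(nat \<Rightarrow>\<^sub>0 nat) \<Rightarrow>\<^sub>0 'a\<close>.
  The variables are $x_1, x_2, \ldots$; the index 0 is not used.
\<close>

type_synonym monomial = "nat \<Rightarrow>\<^sub>0 nat"
type_synonym 'a mpolynomial = "(nat \<Rightarrow>\<^sub>0 nat) \<Rightarrow>\<^sub>0 'a"


section \<open>The polynomial ring in $x_1, \ldots, x_n$\<close>

definition mpoly_ring :: "nat \<Rightarrow> 'a::comm_ring_1 mpolynomial ring" where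
  "mpoly_ring n =
     \<lparr> carrier = {p. \<forall>e \<in> Poly_Mapping.keys p. Poly_Mapping.keys e \<subseteq> {1..n}},
       monoid.mult = (*), one = 1, ring.zero = 0, add = (+) \<rparr>"

lemma cring_mpoly_ring: "cring (mpoly_ring n :: 'a::comm_ring_1 mpolynomial ring)"
proof (intro cringI abelian_groupI comm_monoidI)
  let ?R = "mpoly_ring n :: 'a mpolynomial ring"
  show "x \<otimes>\<^bsub>?R\<^esub> y \<in> carrier ?R" if "x \<in> carrier ?R" "y \<in> carrier ?R" for x y
  proof -
    have "Poly_Mapping.keys e \<subseteq> {1..n}" if e: "e \<in> Poly_Mapping.keys (x * y)" for e
    proof -
      obtain a b where "e = a + b" "a \<in> Poly_Mapping.keys x" "b \<in> Poly_Mapping.keys y"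
        using e keys_mult[of x y] by blast
      then show ?thesis
        using \<open>x \<in> carrier ?R\<close> \<open>y \<in> carrier ?R\<close> Poly_Mapping.keys_add[of a b]
        unfolding mpoly_ring_def by fastforce
    qed
    then show ?thesis by (simp add: mpoly_ring_def)
  qed
  show "x \<oplus>\<^bsub>?R\<^esub> y \<in> carrier ?R" if "x \<in> carrier ?R" "y \<in> carrier ?R" for x y
    using that Poly_Mapping.keys_add[of x y] unfolding mpoly_ring_def by fastforce
  show "\<exists>y \<in> carrier ?R. y \<oplus>\<^bsub>?R\<^esub> x = \<zero>\<^bsub>?R\<^esub>" if "x \<in> carrier ?R" for x
    using that by (intro bexI[of _ "- x"]) (auto simp: mpoly_ring_def)
qed (auto simp: mpoly_ring_def algebra_simps)

definition mono_poly :: "monomial \<Rightarrow> 'a::comm_ring_1 mpolynomial" where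
  "mono_poly e = Poly_Mapping.single e 1"

definition mono_degree :: "monomial \<Rightarrow> nat" where
  "mono_degree e = (\<Sum>v \<in> Poly_Mapping.keys e. Poly_Mapping.lookup e v)"

definition homogeneous :: "nat \<Rightarrow> 'a::comm_ring_1 mpolynomial \<Rightarrow> bool" where
  "homogeneous d p \<longleftrightarrow> (\<forall>e \<in> Poly_Mapping.keys p. mono_degree e = d)"


section \<open>Square-free Borel ideals\<close>

definition squarefree_mono :: "monomial \<Rightarrow> bool" where
  "squarefree_mono e \<longleftrightarrow> (\<forall>v. Poly_Mapping.lookup e v \<le> 1)"

definition borel_move :: "monomial \<Rightarrow> monomial \<Rightarrow> bool" where
  "borel_move e e' \<longleftrightarrow>
     (\<exists>i j. i \<in> Poly_Mapping.keys e \<and> 1 \<le> j \<and> j < i \<and>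
            e' = (e - Poly_Mapping.single i 1) + Poly_Mapping.single j 1)"

text \<open>The intermediate monomials of a sequence of Borel moves need not be square-free.\<close>

definition sfBorel :: "nat \<Rightarrow> monomial \<Rightarrow> 'a::comm_ring_1 mpolynomial set" where
  "sfBorel n m = genideal (mpoly_ring n) {mono_poly e | e. borel_move\<^sup>*\<^sup>* m e \<and> squarefree_mono e}"


section \<open>Symbolic powers and the Waldschmidt constant\<close>

definition primary_ideal :: "('a, 'b) ring_scheme \<Rightarrow> 'a set \<Rightarrow> bool" where
  "primary_ideal R Q \<longleftrightarrow>
     ideal Q R \<and> Q \<noteq> carrier R \<and>
     (\<forall>a \<in> carrier R. \<forall>b \<in> carrier R.
        a \<otimes>\<^bsub>R\<^esub> b \<in> Q \<longrightarrow> a \<in> Q \<or> (\<exists>k::nat. b [^]\<^bsub>R\<^esub> k \<in> Q))"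

definition ideal_radical :: "('a, 'b) ring_scheme \<Rightarrow> 'a set \<Rightarrow> 'a set" where
  "ideal_radical R I = {a \<in> carrier R. \<exists>k::nat. a [^]\<^bsub>R\<^esub> k \<in> I}"

text \<open>
  The intersections are taken inside \<^term>\<open>carrier R\<close>, so that the empty intersection is the
  whole ring.
\<close>

definition minimal_primary_decomposition ::
    "('a, 'b) ring_scheme \<Rightarrow> 'a set \<Rightarrow> 'a set set \<Rightarrow> bool" where
  "minimal_primary_decomposition R I Ps \<longleftrightarrow>
     finite Ps \<and> (\<forall>P \<in> Ps. primary_ideal R P) \<and>
     I = carrier R \<inter> \<Inter>Ps \<and>
     inj_on (ideal_radical R) Ps \<and>
     (\<forall>P \<in> Ps. carrier R \<inter> \<Inter>(Ps - {P}) \<noteq> I)"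

text \<open>
  Meant for square-free monomial ideals: these are radical, so their minimal primary
  decomposition is unique and the definite description below denotes it. The power of an ideal
  is the power in the monoid of ideals under the product of ideals.
\<close>

definition symbolic_power :: "('a, 'b) ring_scheme \<Rightarrow> 'a set \<Rightarrow> nat \<Rightarrow> 'a set" where
  "symbolic_power R I q =
     carrier R \<inter>
     (\<Inter>P \<in> (THE Ps. minimal_primary_decomposition R I Ps). P [^]\<^bsub>ideals_set R\<^esub> q)"

definition homogeneous_generators ::
    "nat \<Rightarrow> 'a::comm_ring_1 mpolynomial set \<Rightarrow> 'a mpolynomial set \<Rightarrow> bool" where
  "homogeneous_generators n J G \<longleftrightarrow>
     G \<subseteq> carrier (mpoly_ring n) \<and> (\<forall>g \<in> G. g \<noteq> 0 \<and> (\<exists>d. homogeneous d g)) \<and>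
     J = genideal (mpoly_ring n) G"

text \<open>
  The smallest degree occurring in a set of nonzero homogeneous generators does not depend on
  the set, so it is harmless to range over all of them.
\<close>

definition initial_degree :: "nat \<Rightarrow> 'a::comm_ring_1 mpolynomial set \<Rightarrow> nat" where
  "initial_degree n J = (LEAST d. \<exists>G g. homogeneous_generators n J G \<and> g \<in> G \<and> homogeneous d g)"

definition waldschmidt :: "nat \<Rightarrow> 'a::comm_ring_1 mpolynomial set \<Rightarrow> real" where
  "waldschmidt n I =
     lim (\<lambda>q. real (initial_degree n (symbolic_power (mpoly_ring n) I q)) / real q)"


section \<open>The tuple $T(m)$\<close>

text \<open>
  A square-free monomial $m = x_{i_1} \cdots x_{i_s}$ with $i_1 < \cdots < i_s$ is given by
  \<open>s\<close> and the function \<open>i\<close>, of which only the values at \<open>1, \<dots>, s\<close> matter.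
\<close>

definition sf_monomial :: "(nat \<Rightarrow> nat) \<Rightarrow> nat \<Rightarrow> monomial" where
  "sf_monomial i s = (\<Sum>j = 1..s. Poly_Mapping.single (i j) 1)"

text \<open>The tuple whose first entry is \<open>t\<close> and in which every entry determines the next one.\<close>

function T_from :: "(nat \<Rightarrow> nat) \<Rightarrow> nat \<Rightarrow> nat list" where
  "T_from i t =
     (let A = {j. 1 \<le> j \<and> j < t \<and> i j < i (j + 1) - 1}
      in t # (if A = {} then [] else T_from i (Max A)))"
  by pat_completeness auto
termination
proof (relation "measure snd")
  fix i :: "nat \<Rightarrow> nat" and t :: nat and A
  assume A: "A = {j. 1 \<le> j \<and> j < t \<and> i j < i (j + 1) - 1}" "A \<noteq> {}"
  have "finite A"
    unfolding A(1) by (rule finite_subset[of _ "{..<t}"]) auto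
  then have "Max A \<in> A" using A(2) by (rule Max_in)
  then show "((i, Max A), i, t) \<in> measure snd" using A(1) by simp
qed simp

declare T_from.simps [simp del]

definition T_tuple :: "(nat \<Rightarrow> nat) \<Rightarrow> nat \<Rightarrow> nat list" where
  "T_tuple i s = T_from i s"

definition IT_tuple :: "(nat \<Rightarrow> nat) \<Rightarrow> nat \<Rightarrow> nat list" where
  "IT_tuple i s = map i (T_tuple i s)"

end

theory Submission
  imports Defs
begin

text \<open>
  A symbolic power of a square-free monomial ideal is again a monomial ideal. Its minimal primes are
  generated by the variables in the minimal vertex covers \<open>C\<close> of the hypergraph of supports
  of the generators, and a monomial lies in the \<open>q\<close>-th power of such a prime iff its exponents
  on \<open>C\<close> add up to at least \<open>q\<close> (\<open>symbolic_power_edge_ideal\<close>). Hence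
  \<open>\<alpha>(I\<^sup>(\<^sup>q\<^sup>))\<close> is the optimum of an integer program: the least degree of an exponent vector
  that puts weight at least \<open>q\<close> on every vertex cover. These optima are subadditive in \<open>q\<close>,
  so by Fekete's argument the quotients by \<open>q\<close> converge, and it suffices to compare
  \<open>\<alpha>(I\<^sup>(\<^sup>q\<^sup>))\<close> with the same number for the smaller ideal for each fixed \<open>q\<close>
  (\<open>cover_degree_borel_ge\<close>).

  For \<open>sfBorel\<close> the supports are the injective images \<open>f ` {1..s}\<close> with
  \<open>f r \<le> i r\<close>. By counting, each set of \<open>i r - r + 1\<close> indices in \<open>{1..i r}\<close> is a
  vertex cover (\<open>borel_vertex_coverI\<close>). Let \<open>t = t\<^bsub>l+1\<^esub>\<close> and \<open>u = t\<^bsub>l\<^esub>\<close>, so that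
  \<open>\<nu> = i t + 1\<close>, and let \<open>m = i \<nu> - \<nu> + 1\<close>. An optimal exponent vector \<open>e\<close> for
  \<open>I\<close> has three disjoint parts, one for each summand of the bound.
  \<^item> Restricted to \<open>{1..i t}\<close>, \<open>e\<close> is feasible for the ideal of the first \<open>t\<close>
    variables (\<open>vertex_cover_restrict_borel\<close>), which accounts for the smaller ideal.
  \<^item> Let \<open>M\<close> be the larger of \<open>i \<nu>\<close> and \<open>i u\<close>. Because \<open>i\<close> takes
    consecutive values on \<open>{t + 1..u}\<close>, every \<open>m\<close>-element subset of \<open>{\<nu>..M}\<close> is a
    vertex cover. Averaging over these subsets, the \<open>s - \<nu>\<close> largest weights in that
    interval have sum at least \<open>q (s - \<nu>) / m\<close>; there is room for them because
    \<open>s \<le> i u \<le> M\<close>.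
  \<^item> Removing these \<open>s - \<nu>\<close> indices from \<open>{\<nu>..i s}\<close> leaves \<open>i s - s + 1\<close> indices,
    which is again a vertex cover and carries weight at least \<open>q\<close>.
\<close>

section \<open>Minimal primary decompositions of radical ideals\<close>

lemma (in primeideal) nat_pow_mem_imp_mem:
  assumes "a \<in> carrier R" "a [^] (k::nat) \<in> I"
  shows "a \<in> I"
  using assms(2)
proof (induction k)
  case 0
  then have "\<one> \<in> I" by simp
  then show ?case using one_imp_carrier I_notcarr by simp
next
  case (Suc k)
  then have "a [^] k \<otimes> a \<in> I" by simp
  then show ?case using I_prime[of "a [^] k" a] assms(1) Suc.IH by auto
qed

lemma (in primeideal) ideal_radical_eq: "ideal_radical R I = I"
proof
  show "ideal_radical R I \<subseteq> I"
    using nat_pow_mem_imp_mem by (auto simp: ideal_radical_def)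
  show "I \<subseteq> ideal_radical R I"
    unfolding ideal_radical_def using Icarr by (auto intro!: exI[of _ "1::nat"])
qed

lemma primeideal_imp_primary:
  assumes "primeideal P R"
  shows "primary_ideal R P"
proof -
  interpret primeideal P R by fact
  show ?thesis
    unfolding primary_ideal_def
  proof (intro conjI ballI impI)
    fix a b assume "a \<in> carrier R" "b \<in> carrier R" "a \<otimes>\<^bsub>R\<^esub> b \<in> P"
    then have "a \<in> P \<or> b [^]\<^bsub>R\<^esub> (1::nat) \<in> P" using I_prime by simp
    then show "a \<in> P \<or> (\<exists>k::nat. b [^]\<^bsub>R\<^esub> k \<in> P)" by blast
  qed (use is_ideal I_notcarr in auto)
qed

text \<open>
  Otherwise a product of elements of the \<open>Q \<in> Qs\<close> that avoid \<open>P\<close> would lie in the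
  intersection but not in \<open>P\<close>.
\<close>

lemma primeideal_contains_member_of_Inter:
  assumes P: "primeideal P R"
    and "finite Qs" "\<forall>Q\<in>Qs. ideal Q R" "carrier R \<inter> \<Inter>Qs \<subseteq> P"
  shows "\<exists>Q\<in>Qs. Q \<subseteq> P"
  using assms(2-)
proof (induction Qs rule: finite_induct)
  case empty
  interpret primeideal P R by (rule P)
  show ?case using empty I_notcarr Icarr by auto
next
  case (insert Q Qs)
  interpret primeideal P R by (rule P)
  show ?case
  proof (rule ccontr)
    assume no: "\<not> ?thesis"
    then obtain a where a: "a \<in> Q" "a \<notin> P" by auto
    from no insert have "\<not> carrier R \<inter> \<Inter>Qs \<subseteq> P" by auto
    then obtain b where b: "b \<in> carrier R" "\<forall>Q'\<in>Qs. b \<in> Q'" "b \<notin> P" by auto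
    have ac: "a \<in> carrier R" using a insert.prems(1) ideal.Icarr by auto
    have "a \<otimes>\<^bsub>R\<^esub> b \<in> Q'" if "Q' \<in> insert Q Qs" for Q'
      using that a b ac insert.prems(1) ideal.I_l_closed ideal.I_r_closed by fastforce
    then have "a \<otimes>\<^bsub>R\<^esub> b \<in> P" using insert.prems(2) ac b(1) by auto
    then show False using I_prime ac a b by auto
  qed
qed

text \<open>
  Every \<open>P \<in> Ps\<close> contains some \<open>Q \<in> Qs\<close>, which contains some \<open>P' \<in> Ps\<close>;
  irredundancy of \<open>Ps\<close> forces \<open>P' = P\<close>, so \<open>P = Q\<close>.
\<close>

lemma irredundant_primes_subset:
  assumes "finite Ps" "\<forall>P\<in>Ps. primeideal P R"
    and "\<forall>P\<in>Ps. carrier R \<inter> \<Inter>(Ps - {P}) \<noteq> I"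
    and "finite Qs" "\<forall>Q\<in>Qs. primeideal Q R"
    and I: "I = carrier R \<inter> \<Inter>Ps" "I = carrier R \<inter> \<Inter>Qs"
  shows "Ps \<subseteq> Qs"
proof
  fix P assume P: "P \<in> Ps"
  have ideals: "\<forall>P\<in>Ps. ideal P R" "\<forall>Q\<in>Qs. ideal Q R"
    using assms(2,5) primeideal.axioms(1) by auto
  obtain Q where Q: "Q \<in> Qs" "Q \<subseteq> P"
    using primeideal_contains_member_of_Inter[of P R Qs] assms(2,4) ideals P I by blast
  obtain P' where P': "P' \<in> Ps" "P' \<subseteq> Q"
    using primeideal_contains_member_of_Inter[of Q R Ps] assms(1,5) ideals Q I by blast
  have "P' = P"
  proof (rule ccontr)
    assume "P' \<noteq> P"
    then have "carrier R \<inter> \<Inter>(Ps - {P}) = carrier R \<inter> \<Inter>Ps"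
      using P' Q P by blast
    then show False using assms(3) P I(1) by auto
  qed
  then show "P \<in> Qs" using P' Q by auto
qed

text \<open>
  Irredundancy gives an \<open>x\<close> in all other components but not in \<open>I\<close>. As \<open>I\<close> is
  radical, no power of \<open>x\<close> lies in \<open>Q\<close>. If a power of \<open>y\<close> lies in \<open>Q\<close>, then a power of
  \<open>y \<otimes> x\<close> lies in \<open>I\<close>, hence \<open>y \<otimes> x\<close> itself is in \<open>Q\<close>, and \<open>y \<in> Q\<close> because
  \<open>Q\<close> is primary. So \<open>Q\<close> is a radical primary ideal, that is, a prime.
\<close>

lemma (in cring) primary_component_of_radical_ideal_prime:
  assumes dec: "minimal_primary_decomposition R I Qs"
    and rad: "\<And>a k. a \<in> carrier R \<Longrightarrow> a [^] (k::nat) \<in> I \<Longrightarrow> a \<in> I"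
    and Q: "Q \<in> Qs"
  shows "primeideal Q R"
proof -
  note d = dec[unfolded minimal_primary_decomposition_def]
  have prim: "primary_ideal R Q" using d Q by auto
  interpret Q: ideal Q R using prim by (simp add: primary_ideal_def)
  have ids: "ideal Q' R" if "Q' \<in> Qs" for Q' using d that by (auto simp: primary_ideal_def)
  have I_eq: "I = carrier R \<inter> \<Inter>Qs" using d by auto
  have "carrier R \<inter> \<Inter>(Qs - {Q}) \<noteq> I" using d Q by auto
  moreover have "I \<subseteq> carrier R \<inter> \<Inter>(Qs - {Q})" using I_eq by auto
  ultimately obtain x where x: "x \<in> carrier R" "\<forall>Q'\<in>Qs - {Q}. x \<in> Q'" "x \<notin> I" by blast
  have into_I: "z \<in> I" if "z \<in> Q" "\<forall>Q'\<in>Qs - {Q}. z \<in> Q'" for z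
    using that Q.Icarr I_eq by auto
  have pow_mem: "z [^] k \<in> Q'" if Q': "Q' \<in> Qs" "z \<in> Q'" and k: "k > 0" for z Q' and k :: nat
  proof -
    interpret Q': ideal Q' R by (rule ids) fact
    obtain k' where "k = Suc k'" using k by (cases k) auto
    then show ?thesis using Q' Q'.Icarr by (simp add: Q'.I_l_closed)
  qed
  have x_rad: "x [^] k \<notin> Q" for k :: nat
  proof
    assume xk: "x [^] k \<in> Q"
    have "x [^] Suc k \<in> Q" using Q.I_r_closed[OF xk x(1)] by simp
    then have "x [^] Suc k \<in> I" using into_I pow_mem x(2) by blast
    then show False using rad[OF x(1)] x(3) by blast
  qed
  have radQ: "y \<in> Q" if y: "y \<in> carrier R" "y [^] k \<in> Q" for y and k :: nat
  proof -
    have yk: "y [^] Suc k \<in> Q" using Q.I_r_closed[OF y(2) y(1)] by simp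
    have "(y \<otimes> x) [^] Suc k \<in> I"
    proof (rule into_I)
      show "(y \<otimes> x) [^] Suc k \<in> Q"
        using Q.I_r_closed[OF yk nat_pow_closed[OF x(1), of "Suc k"]]
        by (simp only: nat_pow_distrib[OF y(1) x(1)])
      show "\<forall>Q'\<in>Qs - {Q}. (y \<otimes> x) [^] Suc k \<in> Q'"
      proof
        fix Q' assume Q': "Q' \<in> Qs - {Q}"
        then have "y \<otimes> x \<in> Q'" using ideal.I_l_closed[OF ids] x y by blast
        then show "(y \<otimes> x) [^] Suc k \<in> Q'" using pow_mem Q' by blast
      qed
    qed
    then have "y \<otimes> x \<in> I" using rad[of "y \<otimes> x"] x y by blast
    then have "y \<otimes> x \<in> Q" using I_eq Q by auto
    then show ?thesis using prim x y x_rad unfolding primary_ideal_def by blast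
  qed
  show ?thesis
  proof (rule primeidealI)
    show "ideal Q R" by (rule Q.is_ideal)
    show "cring R" by (rule is_cring)
    show "carrier R \<noteq> Q" using prim by (auto simp: primary_ideal_def)
    show "a \<in> Q \<or> b \<in> Q" if "a \<in> carrier R" "b \<in> carrier R" "a \<otimes> b \<in> Q" for a b
      using prim that radQ unfolding primary_ideal_def by blast
  qed
qed

text \<open>
  This evaluates the definite description in \<^const>\<open>symbolic_power\<close>: an irredundant
  intersection of finitely many primes has no other minimal primary decomposition.
\<close>

lemma (in cring) minimal_primary_decomposition_iff:
  assumes fin: "finite Ps" and primes: "\<forall>P\<in>Ps. primeideal P R"
    and I: "I = carrier R \<inter> \<Inter>Ps"
    and irr: "\<forall>P\<in>Ps. carrier R \<inter> \<Inter>(Ps - {P}) \<noteq> I"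
  shows "minimal_primary_decomposition R I Qs \<longleftrightarrow> Qs = Ps"
proof
  assume "Qs = Ps"
  moreover have "inj_on (ideal_radical R) Ps"
    using primes by (auto simp: inj_on_def primeideal.ideal_radical_eq)
  ultimately show "minimal_primary_decomposition R I Qs"
    using assms primeideal_imp_primary unfolding minimal_primary_decomposition_def by blast
next
  assume dec: "minimal_primary_decomposition R I Qs"
  have rad: "a \<in> I" if "a \<in> carrier R" "a [^] (k::nat) \<in> I" for a k
  proof -
    have "a \<in> P" if "P \<in> Ps" for P
      using primeideal.nat_pow_mem_imp_mem[of P R a k] that primes \<open>a \<in> carrier R\<close>
        \<open>a [^] k \<in> I\<close> I by auto
    then show ?thesis using \<open>a \<in> carrier R\<close> I by auto
  qed
  have "\<forall>Q\<in>Qs. primeideal Q R"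
    by (blast intro: primary_component_of_radical_ideal_prime[OF dec] rad)
  moreover have "finite Qs" "I = carrier R \<inter> \<Inter>Qs" "\<forall>Q\<in>Qs. carrier R \<inter> \<Inter>(Qs - {Q}) \<noteq> I"
    using dec by (auto simp: minimal_primary_decomposition_def)
  ultimately show "Qs = Ps"
    using irredundant_primes_subset[of Ps R I Qs] irredundant_primes_subset[of Qs R I Ps] assms
    by blast
qed

section \<open>Monomial ideals\<close>

text \<open>
  \<open>U\<close> is meant to be closed under multiplication by monomials; then this is the ideal
  spanned by the monomials in \<open>U\<close>.
\<close>

definition mono_ideal :: "nat \<Rightarrow> monomial set \<Rightarrow> 'a::comm_ring_1 mpolynomial set" where
  "mono_ideal n U = {p \<in> carrier (mpoly_ring n). Poly_Mapping.keys p \<subseteq> U}"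

lemma carrier_mpoly_ring:
  "p \<in> carrier (mpoly_ring n) \<longleftrightarrow> (\<forall>e \<in> Poly_Mapping.keys p. Poly_Mapping.keys e \<subseteq> {1..n})"
  by (simp add: mpoly_ring_def)

lemma mpoly_ring_simps [simp]:
  "x \<otimes>\<^bsub>mpoly_ring n\<^esub> y = x * y" "x \<oplus>\<^bsub>mpoly_ring n\<^esub> y = x + y"
  "\<one>\<^bsub>mpoly_ring n\<^esub> = 1" "\<zero>\<^bsub>mpoly_ring n\<^esub> = 0"
  by (simp_all add: mpoly_ring_def)

lemma single_in_carrier:
  "Poly_Mapping.keys e \<subseteq> {1..n} \<Longrightarrow> Poly_Mapping.single e c \<in> carrier (mpoly_ring n)"
  by (auto simp: carrier_mpoly_ring split: if_splits)

lemma keys_uminus: "Poly_Mapping.keys (- p) = Poly_Mapping.keys (p :: 'b \<Rightarrow>\<^sub>0 'a::ab_group_add)"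
  by (auto simp: in_keys_iff)

lemma keys_add_nat: "Poly_Mapping.keys (a + b) = Poly_Mapping.keys a \<union> Poly_Mapping.keys (b :: monomial)"
  by (auto simp: in_keys_iff lookup_add)

lemma sum_single_lookup:
  "(\<Sum>e \<in> Poly_Mapping.keys p. Poly_Mapping.single e (Poly_Mapping.lookup p e)) = p"
proof (rule poly_mapping_eqI)
  fix k
  have "Poly_Mapping.lookup (\<Sum>e \<in> Poly_Mapping.keys p. Poly_Mapping.single e (Poly_Mapping.lookup p e)) k
    = (\<Sum>e \<in> Poly_Mapping.keys p. if k = e then Poly_Mapping.lookup p e else 0)"
    unfolding lookup_sum by (rule sum.cong) (auto simp: lookup_single when_def)
  also have "\<dots> = Poly_Mapping.lookup p k" by (simp add: in_keys_iff)
  finally show "Poly_Mapping.lookup (\<Sum>e \<in> Poly_Mapping.keys p. Poly_Mapping.single e (Poly_Mapping.lookup p e)) k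
    = Poly_Mapping.lookup p k" .
qed

lemma ideal_mono_ideal:
  fixes U :: "monomial set"
  assumes up: "\<And>e f. e \<in> U \<Longrightarrow> e + f \<in> U"
  shows "ideal (mono_ideal n U :: 'a::comm_ring_1 mpolynomial set) (mpoly_ring n)"
proof -
  let ?R = "mpoly_ring n :: 'a mpolynomial ring"
  let ?I = "mono_ideal n U :: 'a mpolynomial set"
  interpret cring ?R by (rule cring_mpoly_ring)
  have mult: "y * x \<in> ?I" if "x \<in> ?I" "y \<in> carrier ?R" for x y
  proof -
    have "y \<otimes>\<^bsub>?R\<^esub> x \<in> carrier ?R" using that by (intro m_closed) (auto simp: mono_ideal_def)
    moreover have "e \<in> U" if e: "e \<in> Poly_Mapping.keys (y * x)" for e
    proof -
      obtain a b where "e = a + b" "b \<in> Poly_Mapping.keys x"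
        using e keys_mult[of y x] by blast
      then show ?thesis using up[of b a] \<open>x \<in> ?I\<close> by (auto simp: mono_ideal_def add.commute)
    qed
    ultimately show ?thesis by (auto simp: mono_ideal_def)
  qed
  show ?thesis
  proof (rule idealI)
    show "ring ?R" by (rule ring_axioms)
    show "subgroup ?I (add_monoid ?R)"
    proof (rule add.subgroupI)
      show "?I \<subseteq> carrier ?R" by (auto simp: mono_ideal_def)
      have "0 \<in> ?I" using zero_closed by (simp add: mono_ideal_def)
      then show "?I \<noteq> {}" by auto
      fix a assume a: "a \<in> ?I"
      then have ac: "a \<in> carrier ?R" by (simp add: mono_ideal_def)
      have "- a \<in> carrier ?R" using ac by (auto simp: carrier_mpoly_ring keys_uminus)
      then have "\<ominus>\<^bsub>?R\<^esub> a = - a"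
        using minus_equality[of "- a" a] ac by auto
      then show "\<ominus>\<^bsub>?R\<^esub> a \<in> ?I"
        using a by (auto simp: mono_ideal_def carrier_mpoly_ring keys_uminus)
      fix b assume b: "b \<in> ?I"
      show "a \<oplus>\<^bsub>?R\<^esub> b \<in> ?I"
        using a b Poly_Mapping.keys_add[of a b]
        unfolding mono_ideal_def mem_Collect_eq carrier_mpoly_ring mpoly_ring_simps by blast
    qed
    fix a x assume "a \<in> ?I" "x \<in> carrier ?R"
    then show "x \<otimes>\<^bsub>?R\<^esub> a \<in> ?I" "a \<otimes>\<^bsub>?R\<^esub> x \<in> ?I" using mult[of a x] by (auto simp: mult.commute)
  qed
qed

text \<open>
  A polynomial is the sum of its terms, so membership in an ideal can be proved term by term.
\<close>

lemma mem_ideal_if_terms_mem: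
  assumes "ideal J (mpoly_ring n :: 'a::comm_ring_1 mpolynomial ring)"
    and "\<And>e. e \<in> Poly_Mapping.keys p \<Longrightarrow> Poly_Mapping.single e (Poly_Mapping.lookup p e) \<in> J"
  shows "p \<in> J"
proof -
  interpret ideal J "mpoly_ring n" by (rule assms(1))
  have "(\<Sum>e \<in> A. Poly_Mapping.single e (Poly_Mapping.lookup p e)) \<in> J"
    if "A \<subseteq> Poly_Mapping.keys p" for A
  proof -
    have "finite A" using that by (rule finite_subset) simp
    then show ?thesis using that
    proof (induction A rule: finite_induct)
      case empty
      have "\<zero>\<^bsub>mpoly_ring n\<^esub> \<in> J" by (rule additive_subgroup.zero_closed[OF is_additive_subgroup])
      then show ?case by simp
    next
      case (insert e A)
      have "Poly_Mapping.single e (Poly_Mapping.lookup p e) \<oplus>\<^bsub>mpoly_ring n\<^esub>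
          (\<Sum>e \<in> A. Poly_Mapping.single e (Poly_Mapping.lookup p e)) \<in> J"
        using insert assms(2) by (intro additive_subgroup.a_closed[OF is_additive_subgroup]) blast+
      then show ?case using insert by simp
    qed
  qed
  from this[of "Poly_Mapping.keys p"] show ?thesis unfolding sum_single_lookup by blast
qed

text \<open>
  Monomial ideals are described by their monomials: those divisible by a generator.
\<close>

lemma genideal_monomials:
  assumes G: "\<forall>g \<in> G. Poly_Mapping.keys g \<subseteq> {1..n}"
  shows "genideal (mpoly_ring n) {mono_poly e | e. e \<in> G}
    = (mono_ideal n {g + h | g h. g \<in> G} :: 'a::comm_ring_1 mpolynomial set)"
    (is "genideal ?R ?M = ?I")
proof
  interpret cring ?R by (rule cring_mpoly_ring)
  have M: "?M \<subseteq> carrier ?R" using G single_in_carrier unfolding mono_poly_def by blast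
  have "ideal ?I ?R"
    by (rule ideal_mono_ideal) (force simp: add.assoc)
  moreover have "?M \<subseteq> ?I"
    using M by (force simp: mono_ideal_def mono_poly_def intro: exI[of _ 0])
  ultimately show "genideal ?R ?M \<subseteq> ?I" by (rule genideal_minimal)
  interpret J: ideal "genideal ?R ?M" ?R by (rule genideal_ideal[OF M])
  show "?I \<subseteq> genideal ?R ?M"
  proof
    fix p assume p: "p \<in> ?I"
    show "p \<in> genideal ?R ?M"
    proof (rule mem_ideal_if_terms_mem[OF J.is_ideal])
      fix e assume e: "e \<in> Poly_Mapping.keys p"
      then obtain g h where gh: "e = g + h" "g \<in> G" using p by (auto simp: mono_ideal_def)
      have "Poly_Mapping.keys h \<subseteq> {1..n}"
        using p e unfolding gh(1) mono_ideal_def mem_Collect_eq carrier_mpoly_ring by (metis keys_add_nat le_sup_iff)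
      then have h: "Poly_Mapping.single h (Poly_Mapping.lookup p e) \<in> carrier ?R" by (rule single_in_carrier)
      have "mono_poly g \<in> genideal ?R ?M" using genideal_self[OF M] gh(2) by auto
      from J.I_r_closed[OF this h]
      show "Poly_Mapping.single e (Poly_Mapping.lookup p e) \<in> genideal ?R ?M"
        by (simp add: mono_poly_def mult_single gh(1))
    qed
  qed
qed

section \<open>Powers of primes generated by variables\<close>

definition weight_on :: "nat set \<Rightarrow> monomial \<Rightarrow> nat" where
  "weight_on C e = (\<Sum>v\<in>C. Poly_Mapping.lookup e v)"

lemma weight_on_add: "weight_on C (e + f) = weight_on C e + weight_on C f"
  by (simp add: weight_on_def lookup_add sum.distrib)

lemma weight_on_pos_iff: "finite C \<Longrightarrow> 0 < weight_on C e \<longleftrightarrow> Poly_Mapping.keys e \<inter> C \<noteq> {}"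
  unfolding weight_on_def zero_less_iff_neq_zero by (auto simp: in_keys_iff)

lemma ideal_weight_ge:
  "ideal (mono_ideal n {e. q \<le> weight_on C e}) (mpoly_ring n)"
  by (rule ideal_mono_ideal) (simp add: weight_on_add)

text \<open>
  The ideal generated by the variables \<open>x\<^sub>v\<close> with \<open>v \<in> C\<close>, in the form that the description
  of its powers generalizes.
\<close>

definition var_ideal :: "nat \<Rightarrow> nat set \<Rightarrow> 'a::comm_ring_1 mpolynomial set" where
  "var_ideal n C = mono_ideal n {e. 1 \<le> weight_on C e}"

text \<open>
  Splits a polynomial into the part whose monomials satisfy \<open>P\<close> and the rest; used to
  reduce a polynomial modulo a monomial ideal.
\<close>

lemma split_keys_by:
  fixes p :: "'b \<Rightarrow>\<^sub>0 'a::comm_ring_1"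
  obtains a b where "p = a + b" "Poly_Mapping.keys a = {e \<in> Poly_Mapping.keys p. P e}"
    "Poly_Mapping.keys b = {e \<in> Poly_Mapping.keys p. \<not> P e}"
proof -
  define r where "r Q = (\<Sum>e \<in> {e \<in> Poly_Mapping.keys p. Q e}. Poly_Mapping.single e (Poly_Mapping.lookup p e))" for Q
  have look: "Poly_Mapping.lookup (r Q) k = (if Q k then Poly_Mapping.lookup p k else 0)" for Q k
  proof -
    have "Poly_Mapping.lookup (r Q) k = (\<Sum>e \<in> {e \<in> Poly_Mapping.keys p. Q e}. if k = e then Poly_Mapping.lookup p e else 0)"
      unfolding r_def lookup_sum by (rule sum.cong) (auto simp: lookup_single when_def)
    also have "\<dots> = (if Q k then Poly_Mapping.lookup p k else 0)" by (simp add: in_keys_iff)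
    finally show ?thesis .
  qed
  show ?thesis
  proof
    show "p = r P + r (\<lambda>e. \<not> P e)" by (rule poly_mapping_eqI) (simp add: look lookup_add)
    show "Poly_Mapping.keys (r P) = {e \<in> Poly_Mapping.keys p. P e}" by (auto simp: in_keys_iff look split: if_splits)
    show "Poly_Mapping.keys (r (\<lambda>e. \<not> P e)) = {e \<in> Poly_Mapping.keys p. \<not> P e}"
      by (auto simp: in_keys_iff look split: if_splits)
  qed
qed

text \<open>
  Modulo the ideal, \<open>a\<close> and \<open>b\<close> may be replaced by their parts \<open>a0\<close> and \<open>b0\<close> without
  variables in \<open>C\<close>. All monomials of \<open>a0 * b0\<close> avoid \<open>C\<close> as well, so if the product is in
  the ideal, it vanishes, and one of the factors is zero.
\<close>

lemma primeideal_var_ideal: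
  assumes "finite C"
  shows "primeideal (var_ideal n C :: 'a::idom mpolynomial set) (mpoly_ring n)"
proof (rule primeidealI)
  let ?R = "mpoly_ring n :: 'a mpolynomial ring"
  let ?P = "var_ideal n C :: 'a mpolynomial set"
  interpret P: ideal ?P ?R unfolding var_ideal_def by (rule ideal_weight_ge)
  show "ideal ?P ?R" by (rule P.is_ideal)
  show "cring ?R" by (rule cring_mpoly_ring)
  have "\<not> Poly_Mapping.keys (1 :: 'a mpolynomial) \<subseteq> {e. 1 \<le> weight_on C e}"
    by (simp add: weight_on_def)
  then have "\<one>\<^bsub>?R\<^esub> \<notin> ?P" unfolding var_ideal_def mono_ideal_def mpoly_ring_simps by blast
  then show "carrier ?R \<noteq> ?P" using P.one_closed by blast
  fix a b assume a: "a \<in> carrier ?R" and b: "b \<in> carrier ?R" and ab: "a \<otimes>\<^bsub>?R\<^esub> b \<in> ?P"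
  let ?h = "\<lambda>e. 1 \<le> weight_on C e"
  obtain a1 a0 where a01: "a = a1 + a0" "Poly_Mapping.keys a1 = {e \<in> Poly_Mapping.keys a. ?h e}"
    "Poly_Mapping.keys a0 = {e \<in> Poly_Mapping.keys a. \<not> ?h e}" by (rule split_keys_by)
  obtain b1 b0 where b01: "b = b1 + b0" "Poly_Mapping.keys b1 = {e \<in> Poly_Mapping.keys b. ?h e}"
    "Poly_Mapping.keys b0 = {e \<in> Poly_Mapping.keys b. \<not> ?h e}" by (rule split_keys_by)
  have c: "a1 \<in> ?P" "b1 \<in> ?P" "a0 \<in> carrier ?R" "b0 \<in> carrier ?R"
    using a b unfolding var_ideal_def mono_ideal_def mem_Collect_eq carrier_mpoly_ring a01(2,3) b01(2,3)
    by blast+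
  have m1: "- 1 \<in> carrier ?R"
    by (simp add: carrier_mpoly_ring keys_uminus)
  \<comment> \<open>Subtraction is written as multiplication by \<open>- 1\<close>, under which the ideal is closed.\<close>
  have m2: "- 1 * (a1 * b) \<in> ?P" "- 1 * (a0 * b1) \<in> ?P"
    using P.I_l_closed[OF P.I_r_closed[OF c(1) b] m1] P.I_l_closed[OF P.I_l_closed[OF c(2,3)] m1]
    by simp_all
  note add = additive_subgroup.a_closed[OF P.is_additive_subgroup]
  from add[OF ab add[OF m2]]
  have "a * b + (- 1 * (a1 * b) + - 1 * (a0 * b1)) \<in> ?P" by simp
  moreover have "a * b + (- 1 * (a1 * b) + - 1 * (a0 * b1)) = a0 * b0"
    unfolding a01(1) b01(1) by (simp add: distrib_left distrib_right)
  ultimately have "a0 * b0 \<in> ?P" by simp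
  moreover have "e \<notin> Poly_Mapping.keys (a0 * b0)" if "1 \<le> weight_on C e" for e
  proof
    assume "e \<in> Poly_Mapping.keys (a0 * b0)"
    then obtain x y where "e = x + y" "x \<in> Poly_Mapping.keys a0" "y \<in> Poly_Mapping.keys b0"
      using keys_mult[of a0 b0] by blast
    then show False using that a01 b01 by (simp add: weight_on_add)
  qed
  ultimately have "Poly_Mapping.keys (a0 * b0) = {}"
    unfolding var_ideal_def mono_ideal_def by blast
  then have "a0 * b0 = 0" by simp
  then have "a0 = 0 \<or> b0 = 0" by simp
  then show "a \<in> ?P \<or> b \<in> ?P"
  proof
    assume "a0 = 0"
    then show ?thesis using c(1) a01(1) by simp
  next
    assume "b0 = 0"
    then show ?thesis using c(2) b01(1) by simp
  qed
qed

text \<open>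
  A monomial of weight at least \<open>q + 1\<close> on \<open>C\<close> contains a variable \<open>x\<^sub>v\<close> with
  \<open>v \<in> C\<close>; dividing by it leaves weight at least \<open>q\<close>.
\<close>

lemma var_ideal_power:
  assumes "finite C" "C \<subseteq> {1..n}"
  shows "(var_ideal n C :: 'a::comm_ring_1 mpolynomial set) [^]\<^bsub>ideals_set (mpoly_ring n)\<^esub> q
    = mono_ideal n {e. q \<le> weight_on C e}"
proof (induction q)
  case 0
  show ?case by (simp add: ideals_set_def mono_ideal_def)
next
  case (Suc q)
  let ?R = "mpoly_ring n :: 'a mpolynomial ring"
  interpret cring ?R by (rule cring_mpoly_ring)
  let ?A = "mono_ideal n {e. q \<le> weight_on C e} :: 'a mpolynomial set"
  let ?B = "mono_ideal n {e. 1 \<le> weight_on C e} :: 'a mpolynomial set"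
  let ?C = "mono_ideal n {e. Suc q \<le> weight_on C e} :: 'a mpolynomial set"
  have ids: "ideal ?A ?R" "ideal ?B ?R" "ideal ?C ?R" by (rule ideal_weight_ge)+
  have "ideal_prod ?R ?A ?B = ?C"
  proof
    show "ideal_prod ?R ?A ?B \<subseteq> ?C"
    proof
      fix p assume "p \<in> ideal_prod ?R ?A ?B"
      then show "p \<in> ?C"
      proof (induction rule: ideal_prod.induct)
        case (prod a b)
        have "a \<otimes>\<^bsub>?R\<^esub> b \<in> carrier ?R"
          using prod unfolding mono_ideal_def by (intro m_closed) blast+
        moreover have "Suc q \<le> weight_on C e" if e: "e \<in> Poly_Mapping.keys (a * b)" for e
        proof -
          obtain x y where "e = x + y" "x \<in> Poly_Mapping.keys a" "y \<in> Poly_Mapping.keys b"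
            using e keys_mult[of a b] by blast
          moreover from this have "q \<le> weight_on C x" "1 \<le> weight_on C y"
            using prod unfolding mono_ideal_def by blast+
          ultimately show ?thesis by (simp add: weight_on_add)
        qed
        ultimately show ?case by (auto simp: mono_ideal_def)
      next
        case (sum a b)
        then show ?case
          using additive_subgroup.a_closed[OF ideal.axioms(1)[OF ids(3)]] by blast
      qed
    qed
    show "?C \<subseteq> ideal_prod ?R ?A ?B"
    proof
      fix p assume p: "p \<in> ?C"
      show "p \<in> ideal_prod ?R ?A ?B"
      proof (rule mem_ideal_if_terms_mem[OF ideal_prod_is_ideal[OF ids(1,2)]])
        fix e assume e: "e \<in> Poly_Mapping.keys p"
        then have w: "Suc q \<le> weight_on C e" and ke: "Poly_Mapping.keys e \<subseteq> {1..n}"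
          using p unfolding mono_ideal_def mem_Collect_eq carrier_mpoly_ring by blast+
        then obtain v where v: "v \<in> Poly_Mapping.keys e" "v \<in> C"
          using weight_on_pos_iff[OF assms(1), of e] by auto
        define f where "f = e - Poly_Mapping.single v 1"
        have ef: "e = f + Poly_Mapping.single v 1"
          using v(1) by (intro poly_mapping_eqI)
            (auto simp: f_def lookup_add lookup_minus lookup_single when_def in_keys_iff)
        have one: "weight_on C (Poly_Mapping.single v 1) = 1"
          using v(2) assms(1) by (simp add: weight_on_def lookup_single when_def)
        have kf: "Poly_Mapping.keys f \<subseteq> {1..n}" using ke unfolding ef keys_add_nat by auto
        have "Poly_Mapping.single f (Poly_Mapping.lookup p e) \<in> ?A"
          unfolding mono_ideal_def mem_Collect_eq
          using w one by (intro conjI single_in_carrier kf) (auto simp: ef weight_on_add)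
        moreover have "Poly_Mapping.single (Poly_Mapping.single v 1) 1 \<in> ?B"
          using one v ke by (auto simp: mono_ideal_def intro!: single_in_carrier simp del: atLeastAtMost_iff)
        ultimately have "Poly_Mapping.single f (Poly_Mapping.lookup p e) \<otimes>\<^bsub>?R\<^esub> Poly_Mapping.single (Poly_Mapping.single v 1) 1
            \<in> ideal_prod ?R ?A ?B"
          by (rule ideal_prod.prod)
        then show "Poly_Mapping.single e (Poly_Mapping.lookup p e) \<in> ideal_prod ?R ?A ?B"
          by (simp only: mpoly_ring_simps mult_single ef[symmetric] mult_1_right)
      qed
    qed
  qed
  then show ?case using Suc by (simp add: nat_pow_def ideals_set_def var_ideal_def)
qed

section \<open>Symbolic powers of square-free monomial ideals\<close>

definition vertex_covers :: "nat \<Rightarrow> nat set set \<Rightarrow> nat set set" where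
  "vertex_covers n H = {C. C \<subseteq> {1..n} \<and> (\<forall>E\<in>H. E \<inter> C \<noteq> {})}"

definition minimal_vertex_covers :: "nat \<Rightarrow> nat set set \<Rightarrow> nat set set" where
  "minimal_vertex_covers n H = {C \<in> vertex_covers n H. \<forall>D \<in> vertex_covers n H. D \<subseteq> C \<longrightarrow> D = C}"

text \<open>
  The square-free monomial ideal whose generators have the members of \<open>H\<close> as supports.
\<close>

definition edge_ideal :: "nat \<Rightarrow> nat set set \<Rightarrow> 'a::comm_ring_1 mpolynomial set" where
  "edge_ideal n H = mono_ideal n {e. \<exists>E\<in>H. E \<subseteq> Poly_Mapping.keys e}"

lemma finite_vertex_covers: "finite (vertex_covers n H)"
  by (rule finite_subset[of _ "Pow {1..n}"]) (auto simp: vertex_covers_def)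

lemma finite_vertex_cover: "C \<in> vertex_covers n H \<Longrightarrow> finite C"
  by (auto simp: vertex_covers_def intro: finite_subset)

lemma weight_on_mono: "finite D \<Longrightarrow> C \<subseteq> D \<Longrightarrow> weight_on C e \<le> weight_on D e"
  by (simp add: weight_on_def sum_mono2)

lemma vertex_cover_contains_minimal:
  assumes "C \<in> vertex_covers n H"
  obtains D where "D \<in> minimal_vertex_covers n H" "D \<subseteq> C"
  using finite_has_minimal2[OF finite_vertex_covers assms] unfolding minimal_vertex_covers_def by blast

lemma lookup_sum_single:
  "finite A \<Longrightarrow> Poly_Mapping.lookup (\<Sum>v\<in>A. Poly_Mapping.single v q) w = (if w \<in> A then q else 0)"
  for q :: nat
  by (simp add: lookup_sum lookup_single when_def)

lemma mono_ideal_all_eq_Inter: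
  "mono_ideal n {e. \<forall>C\<in>S. Q C e} = carrier (mpoly_ring n) \<inter> (\<Inter>C\<in>S. mono_ideal n {e. Q C e})"
proof (rule Set.set_eqI)
  fix p
  show "p \<in> mono_ideal n {e. \<forall>C\<in>S. Q C e} \<longleftrightarrow>
    p \<in> carrier (mpoly_ring n) \<inter> (\<Inter>C\<in>S. mono_ideal n {e. Q C e})"
    unfolding mono_ideal_def Int_iff INT_iff mem_Collect_eq subset_iff by blast
qed

text \<open>
  A monomial whose support contains no edge misses the complement of its support, and that
  complement is a vertex cover.
\<close>

lemma edge_ideal_eq_Inter:
  assumes "\<forall>E\<in>H. E \<subseteq> {1..n}"
  shows "(edge_ideal n H :: 'a::comm_ring_1 mpolynomial set)
    = carrier (mpoly_ring n) \<inter> \<Inter>(var_ideal n ` minimal_vertex_covers n H)"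
proof -
  have "(\<exists>E\<in>H. E \<subseteq> Poly_Mapping.keys e) \<longleftrightarrow> (\<forall>C\<in>minimal_vertex_covers n H. 1 \<le> weight_on C e)"
    for e :: monomial
  proof
    assume "\<exists>E\<in>H. E \<subseteq> Poly_Mapping.keys e"
    then have "Poly_Mapping.keys e \<inter> C \<noteq> {}" if "C \<in> vertex_covers n H" for C
      using that unfolding vertex_covers_def by blast
    then show "\<forall>C\<in>minimal_vertex_covers n H. 1 \<le> weight_on C e"
      using weight_on_pos_iff[OF finite_vertex_cover, of _ n H e]
      by (auto simp: minimal_vertex_covers_def Suc_le_eq)
  next
    assume min: "\<forall>C\<in>minimal_vertex_covers n H. 1 \<le> weight_on C e"
    show "\<exists>E\<in>H. E \<subseteq> Poly_Mapping.keys e"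
    proof (rule ccontr)
      assume "\<not> ?thesis"
      then have "{1..n} - Poly_Mapping.keys e \<in> vertex_covers n H"
        using assms unfolding vertex_covers_def by blast
      then obtain D where D: "D \<in> minimal_vertex_covers n H" "D \<subseteq> {1..n} - Poly_Mapping.keys e"
        by (rule vertex_cover_contains_minimal)
      then have "finite D" by (auto intro: finite_subset)
      then show False using weight_on_pos_iff[of D e] min D by (fastforce simp: Suc_le_eq)
    qed
  qed
  then show ?thesis
    unfolding edge_ideal_def var_ideal_def by (simp only: mono_ideal_all_eq_Inter)
qed

text \<open>
  The decomposition into the primes of the minimal vertex covers is irredundant: for a minimal
  vertex cover \<open>C\<close>, the product of the variables outside \<open>C\<close> lies in the primes of all other
  minimal vertex covers, but not in that of \<open>C\<close>. In the final description, all vertex covers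
  are allowed, because each contains a minimal one and weights increase with the set.
\<close>

lemma symbolic_power_edge_ideal:
  assumes H: "\<forall>E\<in>H. E \<subseteq> {1..n}"
  shows "symbolic_power (mpoly_ring n) (edge_ideal n H :: 'a::idom mpolynomial set) q
    = mono_ideal n {e. \<forall>C\<in>vertex_covers n H. q \<le> weight_on C e}"
proof -
  let ?R = "mpoly_ring n :: 'a mpolynomial ring"
  let ?I = "edge_ideal n H :: 'a mpolynomial set"
  let ?Ps = "(var_ideal n ` minimal_vertex_covers n H) :: 'a mpolynomial set set"
  interpret cring ?R by (rule cring_mpoly_ring)
  have min: "C \<in> vertex_covers n H" "finite C" "C \<subseteq> {1..n}" if "C \<in> minimal_vertex_covers n H" for C
    using that finite_vertex_cover by (auto simp: minimal_vertex_covers_def vertex_covers_def)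
  have I: "?I = carrier ?R \<inter> \<Inter>?Ps" by (rule edge_ideal_eq_Inter[OF H])
  have fin: "finite ?Ps" using finite_vertex_covers[of n H] by (auto simp: minimal_vertex_covers_def)
  have primes: "\<forall>P\<in>?Ps. primeideal P ?R" using primeideal_var_ideal min(2) by blast
  have "carrier ?R \<inter> \<Inter>(?Ps - {P}) \<noteq> ?I" if "P \<in> ?Ps" for P
  proof -
    obtain C where C: "C \<in> minimal_vertex_covers n H" "P = var_ideal n C" using \<open>P \<in> ?Ps\<close> by auto
    define e :: monomial where "e = (\<Sum>v\<in>{1..n} - C. Poly_Mapping.single v 1)"
    have keys_e: "Poly_Mapping.keys e = {1..n} - C"
      using lookup_sum_single[of "{1..n} - C" 1] by (auto simp: in_keys_iff e_def split: if_splits)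
    have "mono_poly e \<notin> P"
      using weight_on_pos_iff[OF min(2)[OF C(1)], of e] keys_e
      by (auto simp: C(2) var_ideal_def mono_ideal_def mono_poly_def)
    then have "mono_poly e \<notin> ?I" using I that by blast
    moreover have e_carr: "mono_poly e \<in> carrier ?R"
      unfolding mono_poly_def by (rule single_in_carrier) (auto simp: keys_e)
    moreover have "mono_poly e \<in> P'" if P': "P' \<in> ?Ps - {P}" for P'
    proof -
      obtain D where D: "D \<in> minimal_vertex_covers n H" "P' = var_ideal n D" "D \<noteq> C"
        using P' C(2) by blast
      then have "\<not> D \<subseteq> C" using C min(1)[OF D(1)] by (auto simp: minimal_vertex_covers_def)
      then have "Poly_Mapping.keys e \<inter> D \<noteq> {}" using min(3)[OF D(1)] keys_e by auto
      then have "1 \<le> weight_on D e" using weight_on_pos_iff[OF min(2)[OF D(1)]] by (simp add: Suc_le_eq)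
      then show ?thesis
        using e_carr by (simp add: D(2) var_ideal_def mono_ideal_def mono_poly_def)
    qed
    ultimately show ?thesis by blast
  qed
  then have "\<forall>P\<in>?Ps. carrier ?R \<inter> \<Inter>(?Ps - {P}) \<noteq> ?I" by (rule ballI)
  note minimal_primary_decomposition_iff[OF fin primes I this]
  then have the: "(THE Qs. minimal_primary_decomposition ?R ?I Qs) = ?Ps" by simp
  have "symbolic_power ?R ?I q
    = carrier ?R \<inter> (\<Inter>C\<in>minimal_vertex_covers n H. mono_ideal n {e. q \<le> weight_on C e})"
    unfolding symbolic_power_def the image_image
    by (intro arg_cong2[where f = "(\<inter>)"] refl INF_cong var_ideal_power min(2,3))
  also have "\<dots> = mono_ideal n {e. \<forall>C\<in>minimal_vertex_covers n H. q \<le> weight_on C e}"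
    by (rule mono_ideal_all_eq_Inter[symmetric])
  also have "{e. \<forall>C\<in>minimal_vertex_covers n H. q \<le> weight_on C e} = {e. \<forall>C\<in>vertex_covers n H. q \<le> weight_on C e}"
  proof -
    have "q \<le> weight_on C e" if e: "\<forall>C\<in>minimal_vertex_covers n H. q \<le> weight_on C e" and C: "C \<in> vertex_covers n H" for C e
    proof -
      obtain D where "D \<in> minimal_vertex_covers n H" "D \<subseteq> C" by (rule vertex_cover_contains_minimal[OF C])
      then show ?thesis using e weight_on_mono[OF finite_vertex_cover[OF C], of D e] by force
    qed
    then show ?thesis by (auto simp: minimal_vertex_covers_def)
  qed
  finally show ?thesis .
qed

text \<open>
  A nonzero homogeneous element of the ideal has the degree of each of its monomials, and
  these are in \<open>U\<close>; conversely, all monomials in \<open>U\<close> together form a set of homogeneous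
  generators.
\<close>

lemma initial_degree_mono_ideal:
  fixes U :: "monomial set"
  assumes up: "\<And>e f. e \<in> U \<Longrightarrow> e + f \<in> U"
  shows "initial_degree n (mono_ideal n U :: 'a::comm_ring_1 mpolynomial set)
    = (LEAST d. \<exists>e\<in>U. Poly_Mapping.keys e \<subseteq> {1..n} \<and> mono_degree e = d)"
proof -
  let ?R = "mpoly_ring n :: 'a mpolynomial ring"
  let ?J = "mono_ideal n U :: 'a mpolynomial set"
  interpret cring ?R by (rule cring_mpoly_ring)
  define E where "E = {e \<in> U. Poly_Mapping.keys e \<subseteq> {1..n}}"
  let ?M = "{mono_poly e | e. e \<in> E} :: 'a mpolynomial set"
  have "(\<exists>G g. homogeneous_generators n ?J G \<and> g \<in> G \<and> homogeneous d g) \<longleftrightarrow>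
      (\<exists>e\<in>U. Poly_Mapping.keys e \<subseteq> {1..n} \<and> mono_degree e = d)" for d
  proof
    assume "\<exists>G g. homogeneous_generators n ?J G \<and> g \<in> G \<and> homogeneous d g"
    then obtain G g where G: "G \<subseteq> carrier ?R" "?J = genideal ?R G"
      and g: "g \<in> G" "g \<noteq> 0" "homogeneous d g"
      by (auto simp: homogeneous_generators_def)
    have "g \<in> ?J" using genideal_self[OF G(1)] g(1) G(2) by auto
    moreover obtain e where e: "e \<in> Poly_Mapping.keys g" using g(2) by fastforce
    ultimately show "\<exists>e\<in>U. Poly_Mapping.keys e \<subseteq> {1..n} \<and> mono_degree e = d"
      using g(3) unfolding homogeneous_def mono_ideal_def carrier_mpoly_ring by blast
  next
    assume "\<exists>e\<in>U. Poly_Mapping.keys e \<subseteq> {1..n} \<and> mono_degree e = d"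
    then obtain e where e: "e \<in> E" "mono_degree e = d" by (auto simp: E_def)
    have "genideal ?R ?M = mono_ideal n {g + h | g h. g \<in> E}"
      by (rule genideal_monomials) (simp add: E_def)
    also have "\<dots> = ?J"
    proof -
      have "f = f + 0 \<and> f \<in> E" if "f \<in> U" "Poly_Mapping.keys f \<subseteq> {1..n}" for f
        using that by (simp add: E_def)
      then have "{f \<in> {g + h | g h. g \<in> E}. Poly_Mapping.keys f \<subseteq> {1..n}} = {f \<in> U. Poly_Mapping.keys f \<subseteq> {1..n}}"
        using up unfolding E_def by blast
      then have "f \<in> {g + h | g h. g \<in> E} \<longleftrightarrow> f \<in> U" if "Poly_Mapping.keys f \<subseteq> {1..n}" for f
        using that by blast
      then show ?thesis
        unfolding mono_ideal_def carrier_mpoly_ring by (intro Collect_cong) blast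
    qed
    finally have J: "?J = genideal ?R ?M" by (rule sym)
    have M: "?M \<subseteq> carrier ?R"
      using single_in_carrier unfolding E_def mono_poly_def by blast
    have nz: "mono_poly f \<noteq> (0 :: 'a mpolynomial)"
      and hom: "homogeneous (mono_degree f) (mono_poly f :: 'a mpolynomial)" for f
      by (simp_all add: mono_poly_def homogeneous_def flip: keys_eq_empty)
    have "g \<noteq> 0 \<and> (\<exists>d. homogeneous d g)" if g: "g \<in> ?M" for g
    proof -
      obtain f where f: "g = mono_poly f" using g by blast
      show ?thesis unfolding f using nz hom by blast
    qed
    then have "\<forall>g\<in>?M. g \<noteq> 0 \<and> (\<exists>d. homogeneous d g)" by (rule ballI)
    with M J have "homogeneous_generators n ?J ?M"
      unfolding homogeneous_generators_def by (intro conjI)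
    moreover have "homogeneous d (mono_poly e :: 'a mpolynomial)"
      using hom[of e] e(2) by simp
    moreover have "mono_poly e \<in> ?M" using e(1) by blast
    ultimately show "\<exists>G g. homogeneous_generators n ?J G \<and> g \<in> G \<and> homogeneous d g" by blast
  qed
  then show ?thesis unfolding initial_degree_def by simp
qed

text \<open>
  The initial degree of the \<open>q\<close>-th symbolic power of the edge ideal, as the value of an
  integer program.
\<close>

definition cover_degree :: "nat \<Rightarrow> nat set set \<Rightarrow> nat \<Rightarrow> nat" where
  "cover_degree n H q =
    (LEAST d. \<exists>e. (\<forall>C\<in>vertex_covers n H. q \<le> weight_on C e) \<and> Poly_Mapping.keys e \<subseteq> {1..n} \<and> weight_on {1..n} e = d)"

lemma mono_degree_eq_weight_on:
  "Poly_Mapping.keys e \<subseteq> {1..n} \<Longrightarrow> mono_degree e = weight_on {1..n} e"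
  unfolding mono_degree_def weight_on_def
  by (rule sum.mono_neutral_left) (auto simp: in_keys_iff)

lemma initial_degree_symbolic_power:
  assumes "\<forall>E\<in>H. E \<subseteq> {1..n}"
  shows "initial_degree n (symbolic_power (mpoly_ring n) (edge_ideal n H :: 'a::idom mpolynomial set) q)
    = cover_degree n H q"
proof -
  have *: "(\<exists>e\<in>{e. \<forall>C\<in>vertex_covers n H. q \<le> weight_on C e}. Poly_Mapping.keys e \<subseteq> {1..n} \<and> mono_degree e = d) \<longleftrightarrow>
      (\<exists>e. (\<forall>C\<in>vertex_covers n H. q \<le> weight_on C e) \<and> Poly_Mapping.keys e \<subseteq> {1..n} \<and> weight_on {1..n} e = d)" for d
    using mono_degree_eq_weight_on[of _ n] by auto
  show ?thesis
    unfolding symbolic_power_edge_ideal[OF assms] cover_degree_def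
    by (subst initial_degree_mono_ideal, force simp: weight_on_add) (simp only: *)
qed

text \<open>
  The exponent vector with all entries \<open>q\<close> is feasible, since a hypergraph that has an edge
  has no empty vertex cover.
\<close>

lemma cover_degree_attained:
  assumes "H \<noteq> {}"
  obtains e where "\<forall>C\<in>vertex_covers n H. q \<le> weight_on C e" "Poly_Mapping.keys e \<subseteq> {1..n}"
    "weight_on {1..n} e = cover_degree n H q"
proof -
  define e :: monomial where "e = (\<Sum>v\<in>{1..n}. Poly_Mapping.single v q)"
  have look: "Poly_Mapping.lookup e v = (if v \<in> {1..n} then q else 0)" for v
    unfolding e_def by (rule lookup_sum_single) simp
  have "q \<le> weight_on C e" if C: "C \<in> vertex_covers n H" for C
  proof -
    have "C \<noteq> {}" "C \<subseteq> {1..n}" using C assms by (auto simp: vertex_covers_def)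
    moreover have "weight_on C e = (\<Sum>v\<in>C. q)"
      unfolding weight_on_def using \<open>C \<subseteq> {1..n}\<close> by (intro sum.cong) (auto simp: look)
    ultimately show ?thesis using finite_vertex_cover[OF C] by (simp add: Suc_le_eq card_gt_0_iff)
  qed
  moreover have "Poly_Mapping.keys e \<subseteq> {1..n}" by (auto simp: in_keys_iff look split: if_splits)
  ultimately have "\<exists>d e. (\<forall>C\<in>vertex_covers n H. q \<le> weight_on C e) \<and> Poly_Mapping.keys e \<subseteq> {1..n} \<and> weight_on {1..n} e = d"
    by blast
  from LeastI_ex[OF this] show ?thesis using that unfolding cover_degree_def by blast
qed

lemma cover_degree_le:
  assumes "\<forall>C\<in>vertex_covers n H. q \<le> weight_on C e" "Poly_Mapping.keys e \<subseteq> {1..n}"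
  shows "cover_degree n H q \<le> weight_on {1..n} e"
  unfolding cover_degree_def using assms by (intro Least_le) blast

lemma cover_degree_add_le:
  assumes "H \<noteq> {}"
  shows "cover_degree n H (p + q) \<le> cover_degree n H p + cover_degree n H q"
proof -
  obtain e where e: "\<forall>C\<in>vertex_covers n H. p \<le> weight_on C e" "Poly_Mapping.keys e \<subseteq> {1..n}"
    "weight_on {1..n} e = cover_degree n H p" by (rule cover_degree_attained[OF assms])
  obtain f where f: "\<forall>C\<in>vertex_covers n H. q \<le> weight_on C f" "Poly_Mapping.keys f \<subseteq> {1..n}"
    "weight_on {1..n} f = cover_degree n H q" by (rule cover_degree_attained[OF assms])
  have "cover_degree n H (p + q) \<le> weight_on {1..n} (e + f)"
    using e f by (intro cover_degree_le) (auto simp: weight_on_add keys_add_nat add_mono)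
  then show ?thesis using e(3) f(3) by (simp add: weight_on_add)
qed

section \<open>Existence of the Waldschmidt limit\<close>

text \<open>
  Fekete's lemma: the limit is the infimum \<open>L\<close>. If \<open>f m / m\<close> is close to \<open>L\<close>, division
  with remainder gives \<open>f q \<le> (q div m) * f m + B\<close> with \<open>B\<close> independent of \<open>q\<close>.
\<close>

lemma subadditive_quotient_convergent:
  fixes f :: "nat \<Rightarrow> nat"
  assumes sub: "\<And>a b. f (a + b) \<le> f a + f b"
  shows "convergent (\<lambda>q. real (f q) / real q)"
proof -
  define L where "L = (INF q\<in>{1..}. real (f q) / real q)"
  have bdd: "bdd_below ((\<lambda>q. real (f q) / real q) ` {1..})" by (rule bdd_belowI[of _ 0]) auto
  have mult: "f (a * m + b) \<le> a * f m + f b" for a m b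
  proof (induction a)
    case (Suc a)
    then show ?case using sub[of m "a * m + b"] by (simp add: add.assoc)
  qed simp
  have "(\<lambda>q. real (f q) / real q) \<longlonglongrightarrow> L"
  proof (rule LIMSEQ_I)
    fix r :: real assume r: "0 < r"
    have "\<exists>m\<in>{1..}. real (f m) / real m < L + r / 2"
      using cINF_less_iff[OF _ bdd, of "L + r / 2"] r by (auto simp: L_def)
    then obtain m where m: "1 \<le> m" "real (f m) / real m < L + r / 2" by auto
    define B where "B = real (f 0 + m * f 1)"
    obtain N where N: "2 * B / r < real N" using reals_Archimedean2 by blast
    show "\<exists>no. \<forall>q\<ge>no. norm (real (f q) / real q - L) < r"
    proof (intro exI[of _ "max 1 N"] allI impI)
      fix q assume "max 1 N \<le> q"
      then have q: "1 \<le> q" "2 * B / r < real q" using N by auto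
      have "L \<le> real (f q) / real q" unfolding L_def using q by (intro cINF_lower[OF bdd]) auto
      moreover have "real (f q) / real q < L + r"
      proof -
        have "f q \<le> (q div m) * f m + f (q mod m)" using mult[of "q div m" m "q mod m"] by simp
        also have "f (q mod m) \<le> (q mod m) * f 1 + f 0" using mult[of "q mod m" 1 0] by simp
        also have "(q mod m) * f 1 \<le> m * f 1" using m(1) by (intro mult_right_mono) (simp_all add: less_imp_le)
        finally have "f q \<le> (q div m) * f m + (m * f 1 + f 0)" by simp
        then have "real (f q) \<le> real (q div m) * real (f m) + B"
          unfolding B_def by (metis add.commute of_nat_add of_nat_le_iff of_nat_mult)
        also have "\<dots> \<le> (real q / real m) * real (f m) + B"
          by (intro add_right_mono mult_right_mono) (auto intro: of_nat_div_le_of_nat)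
        also have "\<dots> < real q * (L + r / 2) + real q * (r / 2)"
        proof -
          have "(real q / real m) * real (f m) < real q * (L + r / 2)"
            using mult_strict_left_mono[OF m(2), of "real q"] q(1) by (simp add: mult.commute)
          moreover have "B < real q * (r / 2)" using q(2) r by (simp add: field_simps)
          ultimately show ?thesis by simp
        qed
        finally have "real (f q) < real q * (L + r)" by (simp add: algebra_simps)
        then show ?thesis using q(1) by (simp add: divide_less_eq mult.commute)
      qed
      ultimately show "norm (real (f q) / real q - L) < r" by simp
    qed
  qed
  then show ?thesis by (auto simp: convergent_def)
qed

lemma waldschmidt_edge_ideal_LIMSEQ:
  assumes "\<forall>E\<in>H. E \<subseteq> {1..n}" "H \<noteq> {}"
  shows "(\<lambda>q. real (cover_degree n H q) / real q)
    \<longlonglongrightarrow> waldschmidt n (edge_ideal n H :: 'a::idom mpolynomial set)"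
proof -
  have "convergent (\<lambda>q. real (cover_degree n H q) / real q)"
    by (rule subadditive_quotient_convergent) (rule cover_degree_add_le[OF assms(2)])
  then show ?thesis
    unfolding waldschmidt_def initial_degree_symbolic_power[OF assms(1)]
    by (simp only: convergent_LIMSEQ_iff)
qed

section \<open>Generators and vertex covers of square-free Borel ideals\<close>

text \<open>
  The supports of the generators of a square-free Borel ideal. They are enumerated by injective
  instead of increasing functions, because a Borel move need not preserve the order of the indices.
\<close>

definition borel_edges :: "(nat \<Rightarrow> nat) \<Rightarrow> nat \<Rightarrow> nat set set" where
  "borel_edges i s = {f ` {1..s} | f. inj_on f {1..s} \<and> (\<forall>r\<in>{1..s}. 1 \<le> f r \<and> f r \<le> i r)}"

lemma lookup_sf_monomial:
  "Poly_Mapping.lookup (sf_monomial f s) v = card {r \<in> {1..s}. f r = v}"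
proof -
  have "Poly_Mapping.lookup (sf_monomial f s) v = (\<Sum>r \<in> {1..s}. if f r = v then 1 else 0)"
    unfolding sf_monomial_def lookup_sum lookup_single when_def ..
  also have "\<dots> = card {r \<in> {1..s}. f r = v}"
    by (subst sum.If_cases) (auto simp: Int_def)
  finally show ?thesis .
qed

lemma keys_sf_monomial: "Poly_Mapping.keys (sf_monomial f s) = f ` {1..s}"
proof (rule Set.set_eqI)
  fix v
  have "v \<in> Poly_Mapping.keys (sf_monomial f s) \<longleftrightarrow> {r \<in> {1..s}. f r = v} \<noteq> {}"
    unfolding in_keys_iff lookup_sf_monomial by simp
  then show "v \<in> Poly_Mapping.keys (sf_monomial f s) \<longleftrightarrow> v \<in> f ` {1..s}" by blast
qed

lemma squarefree_sf_monomial_iff: "squarefree_mono (sf_monomial f s) \<longleftrightarrow> inj_on f {1..s}"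
proof -
  have "card {r \<in> {1..s}. f r = v} \<le> 1 \<longleftrightarrow> (\<forall>r\<in>{1..s}. \<forall>r'\<in>{1..s}. f r = v \<longrightarrow> f r' = v \<longrightarrow> r = r')" for v
    unfolding One_nat_def by (subst card_le_Suc0_iff_eq) (simp, blast)
  then have "squarefree_mono (sf_monomial f s) \<longleftrightarrow>
      (\<forall>v. \<forall>r\<in>{1..s}. \<forall>r'\<in>{1..s}. f r = v \<longrightarrow> f r' = v \<longrightarrow> r = r')"
    unfolding squarefree_mono_def lookup_sf_monomial by (simp only:)
  also have "\<dots> \<longleftrightarrow> inj_on f {1..s}" unfolding inj_on_def by blast
  finally show ?thesis .
qed

lemma sf_monomial_cong: "(\<And>r. r \<in> {1..s} \<Longrightarrow> f r = g r) \<Longrightarrow> sf_monomial f s = sf_monomial g s"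
  unfolding sf_monomial_def by (rule sum.cong) auto

lemma sf_monomial_update:
  assumes "r \<in> {1..s}"
  shows "sf_monomial (f(r := j)) s = (sf_monomial f s - Poly_Mapping.single (f r) 1) + Poly_Mapping.single j 1"
proof -
  define R where "R = (\<Sum>r'\<in>{1..s} - {r}. Poly_Mapping.single (f r') (1::nat))"
  have "sf_monomial f s = Poly_Mapping.single (f r) 1 + R"
    unfolding sf_monomial_def R_def using assms by (subst sum.remove[of _ r]) auto
  moreover have "sf_monomial (f(r := j)) s = Poly_Mapping.single j 1 + R"
    unfolding sf_monomial_def R_def using assms by (subst sum.remove[of _ r]) (auto intro: sum.cong)
  ultimately show ?thesis by (simp add: add.commute)
qed

text \<open>
  Writing the reachable monomials with unordered index functions \<open>f\<close> makes a Borel move the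
  change of one value of \<open>f\<close>, without sorting. Conversely, the values of \<open>i\<close> are replaced by
  those of \<open>f\<close> one after the other, each replacement being trivial or a single Borel move.
\<close>

lemma borel_reachable_sf_monomial_iff:
  assumes "\<forall>r\<in>{1..s}. 1 \<le> i r"
  shows "borel_move\<^sup>*\<^sup>* (sf_monomial i s) e \<longleftrightarrow>
    (\<exists>f. e = sf_monomial f s \<and> (\<forall>r\<in>{1..s}. 1 \<le> f r \<and> f r \<le> i r))"
proof
  assume "borel_move\<^sup>*\<^sup>* (sf_monomial i s) e"
  then show "\<exists>f. e = sf_monomial f s \<and> (\<forall>r\<in>{1..s}. 1 \<le> f r \<and> f r \<le> i r)"
  proof (induction rule: rtranclp_induct)
    case base
    then show ?case using assms by blast
  next
    case (step e e')
    then obtain f where f: "e = sf_monomial f s" "\<forall>r\<in>{1..s}. 1 \<le> f r \<and> f r \<le> i r" by blast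
    from step(2) obtain v j where vj: "v \<in> Poly_Mapping.keys e" "1 \<le> j" "j < v"
      "e' = (e - Poly_Mapping.single v 1) + Poly_Mapping.single j 1"
      unfolding borel_move_def by blast
    obtain r where r: "r \<in> {1..s}" "f r = v" using vj(1) unfolding f(1) keys_sf_monomial by blast
    have "e' = sf_monomial (f(r := j)) s"
      using vj(4) unfolding f(1) r(2)[symmetric] sf_monomial_update[OF r(1)] .
    moreover have "\<forall>r'\<in>{1..s}. 1 \<le> (f(r := j)) r' \<and> (f(r := j)) r' \<le> i r'"
    proof
      fix r' assume "r' \<in> {1..s}"
      then show "1 \<le> (f(r := j)) r' \<and> (f(r := j)) r' \<le> i r'"
        using bspec[OF f(2), of r'] vj(2,3) r(2) by (cases "r' = r") auto
    qed
    ultimately show ?case by blast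
  qed
next
  assume "\<exists>f. e = sf_monomial f s \<and> (\<forall>r\<in>{1..s}. 1 \<le> f r \<and> f r \<le> i r)"
  then obtain f where f: "e = sf_monomial f s" "\<forall>r\<in>{1..s}. 1 \<le> f r \<and> f r \<le> i r" by blast
  \<comment> \<open>The first \<open>k\<close> values already replaced.\<close>
  define g where "g k = (\<lambda>r. if r \<le> k then f r else i r)" for k
  have "borel_move\<^sup>*\<^sup>* (sf_monomial i s) (sf_monomial (g k) s)" if "k \<le> s" for k
    using that
  proof (induction k)
    case 0
    have "sf_monomial (g 0) s = sf_monomial i s" by (rule sf_monomial_cong) (simp add: g_def)
    then show ?case by simp
  next
    case (Suc k)
    have k: "Suc k \<in> {1..s}" using Suc.prems by simp
    have upd: "g (Suc k) = (g k)(Suc k := f (Suc k))" by (auto simp: g_def fun_eq_iff le_Suc_eq)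
    have gk: "g k (Suc k) = i (Suc k)" by (simp add: g_def)
    have IH: "borel_move\<^sup>*\<^sup>* (sf_monomial i s) (sf_monomial (g k) s)" using Suc by simp
    show ?case
    proof (cases "f (Suc k) = i (Suc k)")
      case True
      then have "g (Suc k) = g k" using upd gk by (metis fun_upd_triv)
      then show ?thesis using IH by simp
    next
      case False
      have f_less: "1 \<le> f (Suc k)" "f (Suc k) < i (Suc k)" using bspec[OF f(2) k] False by auto
      have "i (Suc k) \<in> Poly_Mapping.keys (sf_monomial (g k) s)"
        unfolding keys_sf_monomial using k gk by (intro image_eqI[of _ _ "Suc k"]) auto
      then have "borel_move (sf_monomial (g k) s) (sf_monomial (g (Suc k)) s)"
        unfolding upd sf_monomial_update[OF k] gk borel_move_def using f_less by blast
      then show ?thesis using IH by (rule rtranclp.rtrancl_into_rtrancl[rotated])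
    qed
  qed
  from this[of s] have "borel_move\<^sup>*\<^sup>* (sf_monomial i s) (sf_monomial (g s) s)" by simp
  moreover have "sf_monomial (g s) s = e" unfolding f(1) by (rule sf_monomial_cong) (simp add: g_def)
  ultimately show "borel_move\<^sup>*\<^sup>* (sf_monomial i s) e" by simp
qed

lemma borel_edges_eq_supports:
  assumes "\<forall>r\<in>{1..s}. 1 \<le> i r"
  shows "borel_edges i s = Poly_Mapping.keys ` {e. borel_move\<^sup>*\<^sup>* (sf_monomial i s) e \<and> squarefree_mono e}"
  (is "_ = Poly_Mapping.keys ` ?G")
proof -
  have "?G = {sf_monomial f s | f. inj_on f {1..s} \<and> (\<forall>r\<in>{1..s}. 1 \<le> f r \<and> f r \<le> i r)}"
    unfolding borel_reachable_sf_monomial_iff[OF assms]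
    using squarefree_sf_monomial_iff[of _ s] by blast
  moreover have "Poly_Mapping.keys ` {sf_monomial f s | f. P f} = {Poly_Mapping.keys (sf_monomial f s) | f. P f}"
    for P by blast
  ultimately show ?thesis unfolding borel_edges_def by (simp only: keys_sf_monomial)
qed

lemma borel_edges_subset:
  assumes "i ` {1..s} \<subseteq> {1..n}"
  shows "\<forall>E\<in>borel_edges i s. E \<subseteq> {1..n}"
proof
  fix E assume "E \<in> borel_edges i s"
  then obtain f where f: "E = f ` {1..s}" "\<forall>r\<in>{1..s}. 1 \<le> f r \<and> f r \<le> i r"
    unfolding borel_edges_def by blast
  have "f r \<in> {1..n}" if "r \<in> {1..s}" for r
  proof -
    have "i r \<in> {1..n}" using assms that by blast
    then show ?thesis using bspec[OF f(2) that] by simp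
  qed
  then show "E \<subseteq> {1..n}" using f(1) by blast
qed

lemma squarefree_dvd_iff:
  assumes "squarefree_mono g"
  shows "(\<exists>h. e = g + h) \<longleftrightarrow> Poly_Mapping.keys g \<subseteq> Poly_Mapping.keys e"
proof
  assume "\<exists>h. e = g + h"
  then show "Poly_Mapping.keys g \<subseteq> Poly_Mapping.keys e" by (auto simp: keys_add_nat)
next
  assume sub: "Poly_Mapping.keys g \<subseteq> Poly_Mapping.keys e"
  have "Poly_Mapping.lookup g v \<le> Poly_Mapping.lookup e v" for v
  proof (cases "v \<in> Poly_Mapping.keys g")
    case True
    then have "v \<in> Poly_Mapping.keys e" using sub by blast
    then have "0 < Poly_Mapping.lookup e v" by (simp add: in_keys_iff)
    moreover have "Poly_Mapping.lookup g v \<le> 1" using assms by (simp add: squarefree_mono_def)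
    ultimately show ?thesis by linarith
  qed (simp add: in_keys_iff)
  then have "e = g + (e - g)" by (intro poly_mapping_eqI) (simp add: lookup_add lookup_minus)
  then show "\<exists>h. e = g + h" by blast
qed

lemma sfBorel_eq_edge_ideal:
  assumes "i ` {1..s} \<subseteq> {1..n}"
  shows "sfBorel n (sf_monomial i s) = (edge_ideal n (borel_edges i s) :: 'a::comm_ring_1 mpolynomial set)"
proof -
  have pos: "\<forall>r\<in>{1..s}. 1 \<le> i r" using assms by auto
  let ?G = "{e. borel_move\<^sup>*\<^sup>* (sf_monomial i s) e \<and> squarefree_mono e}"
  have keys: "borel_edges i s = Poly_Mapping.keys ` ?G" by (rule borel_edges_eq_supports[OF pos])
  have "\<forall>g\<in>?G. Poly_Mapping.keys g \<subseteq> {1..n}"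
    using borel_edges_subset[OF assms] unfolding keys by blast
  from genideal_monomials[OF this]
  have "sfBorel n (sf_monomial i s) = (mono_ideal n {g + h | g h. g \<in> ?G} :: 'a mpolynomial set)"
    by (simp add: sfBorel_def)
  also have "{g + h | g h. g \<in> ?G} = {e. \<exists>E\<in>borel_edges i s. E \<subseteq> Poly_Mapping.keys e}"
  proof (rule Collect_cong)
    fix e
    have "(\<exists>g h. e = g + h \<and> g \<in> ?G) \<longleftrightarrow> (\<exists>g\<in>?G. \<exists>h. e = g + h)" by blast
    also have "\<dots> \<longleftrightarrow> (\<exists>g\<in>?G. Poly_Mapping.keys g \<subseteq> Poly_Mapping.keys e)"
      using squarefree_dvd_iff by (intro bex_cong refl) blast
    finally show "(\<exists>g h. e = g + h \<and> g \<in> ?G) \<longleftrightarrow> (\<exists>E\<in>borel_edges i s. E \<subseteq> Poly_Mapping.keys e)"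
      unfolding keys by simp
  qed
  finally show ?thesis by (simp add: edge_ideal_def)
qed

lemma borel_edges_nonempty:
  assumes "strict_mono_on {1..s} i" "i ` {1..s} \<subseteq> {1..n}"
  shows "borel_edges i s \<noteq> {}"
proof -
  have "inj_on i {1..s}" using assms(1) by (simp add: strict_mono_on_imp_inj_on)
  moreover have "\<forall>r\<in>{1..s}. 1 \<le> i r \<and> i r \<le> i r" using assms(2) by auto
  ultimately have "i ` {1..s} \<in> borel_edges i s" unfolding borel_edges_def by blast
  then show ?thesis by blast
qed

text \<open>
  The first \<open>r\<close> values of \<open>f\<close> are distinct numbers in \<open>{1..i r}\<close>, so there is no room for
  \<open>C\<close> beside them.
\<close>

lemma borel_vertex_coverI:
  assumes mono: "strict_mono_on {1..s} i" and r: "r \<in> {1..s}"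
    and C: "C \<subseteq> {1..i r}" "C \<subseteq> {1..n}" "i r < card C + r"
  shows "C \<in> vertex_covers n (borel_edges i s)"
proof -
  have "E \<inter> C \<noteq> {}" if "E \<in> borel_edges i s" for E
  proof
    assume disj: "E \<inter> C = {}"
    obtain f where f: "E = f ` {1..s}" "inj_on f {1..s}" "\<forall>r\<in>{1..s}. 1 \<le> f r \<and> f r \<le> i r"
      using \<open>E \<in> borel_edges i s\<close> unfolding borel_edges_def by blast
    have sub: "{1..r} \<subseteq> {1..s}" using r by auto
    have "f a \<in> {1..i r}" if a: "a \<in> {1..r}" for a
    proof -
      have "a \<in> {1..s}" using a sub by blast
      then have "i a \<le> i r" using mono r a
        by (auto simp: strict_mono_on_leD)
      then show ?thesis using bspec[OF f(3) \<open>a \<in> {1..s}\<close>] by simp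
    qed
    then have "f ` {1..r} \<union> C \<subseteq> {1..i r}" using C(1) by blast
    then have "card (f ` {1..r} \<union> C) \<le> i r" using card_mono[of "{1..i r}"] by simp
    moreover have "f ` {1..r} \<inter> C = {}" using disj f(1) sub by blast
    moreover have "card (f ` {1..r}) = r" using card_image[OF inj_on_subset[OF f(2) sub]] by simp
    moreover have "finite C" using C(1) by (rule finite_subset) simp
    ultimately have "r + card C \<le> i r" by (simp add: card_Un_disjoint)
    then show False using C(3) by simp
  qed
  then show ?thesis using C(2) by (simp add: vertex_covers_def)
qed

text \<open>
  The first \<open>t\<close> values of \<open>f\<close> form an edge of the smaller hypergraph inside
  \<open>{1..i t}\<close>, so every edge of the larger hypergraph contains an edge of the smaller one.
\<close>

lemma vertex_cover_restrict_borel: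
  assumes mono: "strict_mono_on {1..s} i" and t: "t \<in> {1..s}"
    and C: "C \<in> vertex_covers n (borel_edges i t)"
  shows "C \<inter> {1..i t} \<in> vertex_covers n (borel_edges i s)"
proof -
  have "E \<inter> (C \<inter> {1..i t}) \<noteq> {}" if "E \<in> borel_edges i s" for E
  proof -
    obtain f where f: "E = f ` {1..s}" "inj_on f {1..s}" "\<forall>r\<in>{1..s}. 1 \<le> f r \<and> f r \<le> i r"
      using \<open>E \<in> borel_edges i s\<close> unfolding borel_edges_def by blast
    have sub: "{1..t} \<subseteq> {1..s}" using t by auto
    have "f ` {1..t} \<in> borel_edges i t"
      unfolding borel_edges_def using inj_on_subset[OF f(2) sub] f(3) sub by blast
    then obtain a where a: "a \<in> {1..t}" "f a \<in> C" using C unfolding vertex_covers_def by blast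
    have "a \<in> {1..s}" using a sub by blast
    then have "i a \<le> i t" using mono t a
      by (auto simp: strict_mono_on_leD)
    then have "f a \<in> {1..i t}" using bspec[OF f(3) \<open>a \<in> {1..s}\<close>] by simp
    then show ?thesis using a(2) f(1) \<open>a \<in> {1..s}\<close> by blast
  qed
  then show ?thesis using C unfolding vertex_covers_def by blast
qed

section \<open>The lower bound for a fixed symbolic power\<close>

text \<open>
  The \<open>k\<close> largest weights have at least the average weight. The proof discards an element of
  least weight as long as the set is too large.
\<close>

lemma exists_heavy_subset:
  fixes w :: "'b \<Rightarrow> real"
  assumes "finite A" "k \<le> card A"
  shows "\<exists>W\<subseteq>A. card W = k \<and> real k * sum w A \<le> real (card A) * sum w W"
  using assms
proof (induction "card A" arbitrary: A)
  case 0
  then show ?case by (intro exI[of _ "{}"]) auto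
next
  case (Suc N)
  show ?case
  proof (cases "k = Suc N")
    case True
    then show ?thesis using Suc.hyps(2) by (intro exI[of _ A]) auto
  next
    case False
    have "A \<noteq> {}" using Suc.hyps(2) by auto
    then obtain a where a: "a \<in> A" "\<forall>b\<in>A. w a \<le> w b"
      using finite_imageI[OF Suc.prems(1), of w] Min_in[of "w ` A"] Min_le[of "w ` A"] by fastforce
    have cA: "card A = Suc N" using Suc.hyps(2) by simp
    then have cA': "card (A - {a}) = N" using a(1) Suc.prems(1) by simp
    have kN: "k \<le> N" using False Suc.prems(2) cA by simp
    obtain W where W: "W \<subseteq> A - {a}" "card W = k"
      "real k * sum w (A - {a}) \<le> real N * sum w W"
      using Suc.hyps(1)[of "A - {a}"] cA' kN Suc.prems(1) by auto
    have sumA: "sum w A = w a + sum w (A - {a})" by (rule sum.remove[OF Suc.prems(1) a(1)])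
    have "(\<Sum>b\<in>A - {a}. w a) \<le> sum w (A - {a})" using a(2) by (intro sum_mono) auto
    then have min: "real N * w a \<le> sum w (A - {a})" by (simp add: cA')
    have "real k * sum w A \<le> real (card A) * sum w W"
    proof (cases "N = 0")
      case True
      then have "k = 0" using kN by simp
      moreover have "W = {}" using W(1) cA' True Suc.prems(1) by auto
      ultimately show ?thesis by simp
    next
      case False
      have "real N * (real k * sum w A) = real k * (real N * w a + real N * sum w (A - {a}))"
        by (simp add: sumA algebra_simps)
      also have "\<dots> \<le> real k * (sum w (A - {a}) + real N * sum w (A - {a}))"
        using min by (intro mult_left_mono) auto
      also have "\<dots> = (real N + 1) * (real k * sum w (A - {a}))" by (simp add: algebra_simps)
      also have "\<dots> \<le> (real N + 1) * (real N * sum w W)" using W(3) by (intro mult_left_mono) auto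
      also have "\<dots> = real N * (real (card A) * sum w W)" by (simp add: cA algebra_simps)
      finally show ?thesis using False by simp
    qed
    then show ?thesis using W by blast
  qed
qed

text \<open>
  If all \<open>m\<close>-element subsets weigh at least \<open>c\<close>, so does the lightest, hence the average
  weight in \<open>A\<close> is at least \<open>c / m\<close>; and the \<open>k\<close> heaviest elements reach at least this
  average.
\<close>

lemma exists_heavy_subset_by_averaging:
  fixes w :: "'b \<Rightarrow> real"
  assumes A: "finite A" "m \<le> card A" "k \<le> card A" and m: "0 < m"
    and heavy: "\<And>B. B \<subseteq> A \<Longrightarrow> card B = m \<Longrightarrow> c \<le> sum w B"
  shows "\<exists>W\<subseteq>A. card W = k \<and> real k * c \<le> real m * sum w W"
proof -
  let ?N = "real (card A)"
  have N: "0 < ?N" using A(2) m by simp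
  obtain B where B: "B \<subseteq> A" "card B = m" "real m * sum (\<lambda>a. - w a) A \<le> ?N * sum (\<lambda>a. - w a) B"
    using exists_heavy_subset[OF A(1,2), of "\<lambda>a. - w a"] by blast
  then have "?N * sum w B \<le> real m * sum w A" by (simp add: sum_negf)
  moreover have "?N * c \<le> ?N * sum w B" using heavy[OF B(1,2)] by (intro mult_left_mono) auto
  ultimately have light: "?N * c \<le> real m * sum w A" by linarith
  obtain W where W: "W \<subseteq> A" "card W = k" "real k * sum w A \<le> ?N * sum w W"
    using exists_heavy_subset[OF A(1,3), of w] by blast
  have "?N * (real k * c) = real k * (?N * c)" by simp
  also have "\<dots> \<le> real k * (real m * sum w A)" using light by (intro mult_left_mono) auto
  also have "\<dots> = real m * (real k * sum w A)" by simp
  also have "\<dots> \<le> real m * (?N * sum w W)" using W(3) by (intro mult_left_mono) auto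
  also have "\<dots> = ?N * (real m * sum w W)" by simp
  finally have "real k * c \<le> real m * sum w W" using N by (simp only: mult_le_cancel_left_pos)
  then show ?thesis using W by blast
qed

text \<open>
  Equivalently, \<open>i j - j\<close> is nondecreasing.
\<close>

lemma strict_mono_on_index_le:
  fixes i :: "nat \<Rightarrow> nat"
  assumes "strict_mono_on {1..s} i" "1 \<le> i 1" "1 \<le> a" "a \<le> b" "b \<le> s"
  shows "i a + (b - a) \<le> i b"
  using assms(4,5)
proof (induction b rule: dec_induct)
  case base
  then show ?case by simp
next
  case (step b)
  have "i b < i (Suc b)"
    using assms(1,3) step.hyps step.prems by (intro strict_mono_onD[OF assms(1)]) auto
  then show ?case using step by simp
qed

text \<open>
  The estimate outlined at the beginning, with \<open>t\<close> and \<open>u\<close> the two consecutive entries of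
  the tuple; \<open>run\<close> says that \<open>i\<close> takes consecutive values on \<open>{t + 1..u}\<close>.
\<close>

lemma cover_degree_borel_ge:
  fixes i :: "nat \<Rightarrow> nat"
  assumes mono: "strict_mono_on {1..s} i" and sub: "i ` {1..s} \<subseteq> {1..n}"
    and t: "1 \<le> t" "t < u" "u \<le> s"
    and run: "\<And>j. t < j \<Longrightarrow> j < u \<Longrightarrow> i (j + 1) = i j + 1"
    and s: "i t < s" "s \<le> i u" and \<nu>: "\<nu> = i t + 1"
  shows "real (cover_degree n (borel_edges i t) q)
      + real q * (1 + (real s - real \<nu>) / (real (i \<nu>) - real \<nu> + 1))
    \<le> real (cover_degree n (borel_edges i s) q)"
proof -
  have pos: "1 \<le> i 1" using sub t by fastforce
  have gap: "i a + (b - a) \<le> i b" if "1 \<le> a" "a \<le> b" "b \<le> s" for a b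
    using strict_mono_on_index_le[OF mono pos that] .
  have ge: "a \<le> i a" if "1 \<le> a" "a \<le> s" for a using gap[of 1 a] that pos by simp
  have \<nu>_s: "\<nu> \<le> s" and t_\<nu>: "t < \<nu>" using s(1) ge[of t] t by (simp_all add: \<nu>)
  have run': "i u = i j + (u - j)" if "t < j" "j \<le> u" for j
    using that(2,1)
  proof (induction j rule: inc_induct)
    case (step j)
    then show ?case using run[of j] by simp
  qed simp
  define M where "M = max (i \<nu>) (i u)"
  define m where "m = i \<nu> - \<nu> + 1"
  have \<nu>_i: "\<nu> \<le> i \<nu>" using ge \<nu>_s t_\<nu> by simp
  \<comment> \<open>Here \<open>m\<close> is the size of the vertex covers inside \<open>{1..M}\<close>. If \<open>\<nu> \<le> u\<close>, then
    \<open>i j - j\<close> is the same for \<open>j = \<nu>\<close> and \<open>j = u\<close>.\<close>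
  obtain r where r: "r \<in> {1..s}" "M = i r" "M + 1 = m + r"
  proof (cases "\<nu> \<le> u")
    case True
    show ?thesis
    proof (rule that[of u])
      show "u \<in> {1..s}" using t by simp
      show "M = i u" using gap[of \<nu> u] True t t_\<nu> by (simp add: M_def)
      then show "M + 1 = m + u" using run'[of \<nu>] t_\<nu> True \<nu>_i by (simp add: m_def)
    qed
  next
    case False
    show ?thesis
    proof (rule that[of \<nu>])
      show "\<nu> \<in> {1..s}" using \<nu>_s t_\<nu> by simp
      show "M = i \<nu>" using gap[of u \<nu>] False t \<nu>_s by (simp add: M_def)
      then show "M + 1 = m + \<nu>" using \<nu>_i by (simp add: m_def)
    qed
  qed
  have sM: "s \<le> M" and M_s: "M \<le> i s"
    using s(2) r gap[of r s] by (auto simp: M_def)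
  have "i s \<in> {1..n}" using t by (intro subsetD[OF sub] imageI) simp
  then have isn: "i s \<le> n" by simp
  obtain e where e: "\<forall>C\<in>vertex_covers n (borel_edges i s). q \<le> weight_on C e" "Poly_Mapping.keys e \<subseteq> {1..n}"
    "weight_on {1..n} e = cover_degree n (borel_edges i s) q"
    by (rule cover_degree_attained[OF borel_edges_nonempty[OF mono sub]])
  define w where "w v = real (Poly_Mapping.lookup e v)" for v
  have weight: "real (weight_on C e) = sum w C" for C by (simp add: weight_on_def w_def)
  have "m \<le> card {\<nu>..M}" using \<nu>_i by (simp add: m_def M_def)
  moreover have "s - \<nu> \<le> card {\<nu>..M}" using sM by simp
  moreover have "real q \<le> sum w B" if B: "B \<subseteq> {\<nu>..M}" "card B = m" for B
  proof -
    have "B \<in> vertex_covers n (borel_edges i s)"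
      using B r M_s isn t_\<nu> by (intro borel_vertex_coverI[OF mono r(1)]) auto
    then show ?thesis using e(1) weight[of B] by fastforce
  qed
  ultimately obtain W where W: "W \<subseteq> {\<nu>..M}" "card W = s - \<nu>" "real (s - \<nu>) * real q \<le> real m * sum w W"
    using exists_heavy_subset_by_averaging[of "{\<nu>..M}" m "s - \<nu>" "real q" w] by (auto simp: m_def)
  have fin_W: "finite W" using W(1) by (rule finite_subset) simp
  define D where "D = {\<nu>..i s} - W"
  have W_sub: "W \<subseteq> {\<nu>..i s}" using W(1) M_s by auto
  have "card D = (i s + 1 - \<nu>) - (s - \<nu>)" unfolding D_def using W_sub W(2) fin_W by (simp add: card_Diff_subset)
  then have "i s < card D + s" using \<nu>_s ge[of s] t by simp
  then have "D \<in> vertex_covers n (borel_edges i s)"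
    using t t_\<nu> isn by (intro borel_vertex_coverI[OF mono, of s]) (auto simp: D_def)
  then have D: "real q \<le> sum w D" using e(1) weight[of D] by fastforce
  \<comment> \<open>The restriction of \<open>e\<close> to the variables of the smaller ideal.\<close>
  define e' where "e' = (\<Sum>v\<in>{1..i t}. Poly_Mapping.single v (Poly_Mapping.lookup e v))"
  have look: "Poly_Mapping.lookup e' v = (if v \<in> {1..i t} then Poly_Mapping.lookup e v else 0)" for v
    unfolding e'_def by (simp add: lookup_sum lookup_single when_def)
  have weight': "weight_on C e' = weight_on (C \<inter> {1..i t}) e" if "finite C" for C
    unfolding weight_on_def look using that by (simp only: sum.inter_restrict)
  have it: "i t \<le> n" using s(1) ge[of s] isn t by simp
  have "cover_degree n (borel_edges i t) q \<le> weight_on {1..n} e'"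
  proof (rule cover_degree_le)
    show "\<forall>C\<in>vertex_covers n (borel_edges i t). q \<le> weight_on C e'"
      using e(1) vertex_cover_restrict_borel[OF mono] weight'[OF finite_vertex_cover] t by auto
    show "Poly_Mapping.keys e' \<subseteq> {1..n}" using it by (auto simp: in_keys_iff look split: if_splits)
  qed
  also have "\<dots> = weight_on {1..i t} e"
    using it by (simp add: weight' Int_absorb1)
  finally have low: "real (cover_degree n (borel_edges i t) q) \<le> sum w {1..i t}"
    using weight[of "{1..i t}"] by simp
  have "sum w {1..i t} + sum w W + sum w D = sum w ({1..i t} \<union> (W \<union> D))"
  proof -
    have "sum w (W \<union> D) = sum w W + sum w D"
      using fin_W by (intro sum.union_disjoint) (auto simp: D_def)
    moreover have "sum w ({1..i t} \<union> (W \<union> D)) = sum w {1..i t} + sum w (W \<union> D)"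
      using fin_W W_sub by (intro sum.union_disjoint) (auto simp: D_def \<nu>)
    ultimately show ?thesis by simp
  qed
  also have "\<dots> \<le> sum w {1..n}"
    using W_sub isn it t_\<nu> by (intro sum_mono2) (auto simp: D_def w_def)
  also have "\<dots> = real (cover_degree n (borel_edges i s) q)" using e(3) weight by metis
  finally have total: "sum w {1..i t} + sum w W + sum w D \<le> real (cover_degree n (borel_edges i s) q)" .
  have m_real: "real m = real (i \<nu>) - real \<nu> + 1" using \<nu>_i by (simp add: m_def of_nat_diff)
  have "real q * ((real s - real \<nu>) / (real (i \<nu>) - real \<nu> + 1)) = real (s - \<nu>) * real q / real m"
    unfolding m_real using \<nu>_s by (simp add: of_nat_diff)
  also have "\<dots> \<le> sum w W" using W(3) by (simp add: m_def divide_le_eq mult.commute)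
  finally show ?thesis using total low D by (simp add: distrib_left)
qed

section \<open>Entries of the tuple $T(m)$\<close>

text \<open>
  The defining recursion of the tuple, read off for two consecutive entries of the list.
\<close>

lemma T_from_nth_Suc:
  assumes "Suc l < length (T_from i s)"
  shows "T_from i s ! Suc l \<in> {j. 1 \<le> j \<and> j < T_from i s ! l \<and> i j < i (j + 1) - 1}
    \<and> (\<forall>j. 1 \<le> j \<and> j < T_from i s ! l \<and> i j < i (j + 1) - 1 \<longrightarrow> j \<le> T_from i s ! Suc l)
    \<and> T_from i s ! l \<le> s"
  using assms
proof (induction i s arbitrary: l rule: T_from.induct)
  case (1 i t)
  define A where "A = {j. 1 \<le> j \<and> j < t \<and> i j < i (j + 1) - 1}"
  have mem_A: "j \<in> A \<longleftrightarrow> 1 \<le> j \<and> j < t \<and> i j < i (j + 1) - 1" for j by (simp add: A_def)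
  have T: "T_from i t = t # (if A = {} then [] else T_from i (Max A))"
    by (subst T_from.simps) (simp only: A_def Let_def)
  have ne: "A \<noteq> {}" using "1.prems" T by auto
  have T_Cons: "T_from i t = t # T_from i (Max A)" using T ne by simp
  have fin: "finite A" unfolding A_def by (rule finite_subset[of _ "{..<t}"]) auto
  have Max: "Max A \<in> A" "\<And>j. j \<in> A \<Longrightarrow> j \<le> Max A" using Max_in[OF fin ne] Max_ge[OF fin] by auto
  have Max_less: "Max A < t" using Max(1) mem_A by blast
  show ?case
  proof (cases l)
    case 0
    have "T_from i (Max A) ! 0 = Max A" by (subst T_from.simps) (simp add: Let_def)
    then show ?thesis using Max mem_A by (auto simp: 0 T_Cons)
  next
    case (Suc l')
    have "Suc l' < length (T_from i (Max A))" using "1.prems" T_Cons Suc by simp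
    from "1.IH"[OF A_def ne this] show ?thesis
      using Max_less by (simp add: T_Cons Suc)
  qed
qed

section \<open>Passage to the limit\<close>

theorem theorem4p4:
  fixes n s k l \<nu> :: nat
    and i :: "nat \<Rightarrow> nat"
    and T IT :: "nat list"
    and I :: "'a::field_char_0 mpolynomial set"
  assumes "1 \<le> s"
    and "strict_mono_on {1..s} i"
    and "i ` {1..s} \<subseteq> {1..n}"
    and "T = T_tuple i s"
    and "IT = IT_tuple i s"
    and "length T = k + 1"
    and "I = sfBorel n (sf_monomial i s)"
    and "l < k"
    and "IT ! (l + 1) < T ! 0 \<and> T ! 0 \<le> IT ! l"
    and "\<forall>l' < l. \<not> (IT ! (l' + 1) < T ! 0 \<and> T ! 0 \<le> IT ! l')"
    and "\<nu> = IT ! (l + 1) + 1"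
  shows "waldschmidt n I \<ge>
           waldschmidt n (sfBorel n (sf_monomial i (T ! (l + 1))) :: 'a mpolynomial set)
           + 1 + (real (T ! 0) - real \<nu>) / (real (i \<nu>) - real \<nu> + 1)"
proof -
  define t where "t = T ! (l + 1)"
  define u where "u = T ! l"
  have T: "T = T_from i s" using assms(4) by (simp add: T_tuple_def)
  have T0: "T ! 0 = s" unfolding T by (subst T_from.simps) (simp add: Let_def)
  have len: "Suc l < length (T_from i s)" using assms(6,8) T by simp
  from T_from_nth_Suc[OF len] have t: "1 \<le> t" "t < u" "u \<le> s"
    and last: "\<And>j. 1 \<le> j \<Longrightarrow> j < u \<Longrightarrow> i j < i (j + 1) - 1 \<Longrightarrow> j \<le> t"
    unfolding t_def u_def T by auto
  have IT: "IT ! (l + 1) = i t" "IT ! l = i u"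
    using assms(5,6,8) by (simp_all add: IT_tuple_def t_def u_def assms(4))
  have run: "i (j + 1) = i j + 1" if "t < j" "j < u" for j
  proof -
    have "i j < i (j + 1)" using that t by (intro strict_mono_onD[OF assms(2)]) auto
    moreover have "\<not> i j < i (j + 1) - 1" using last[of j] that t by auto
    ultimately show ?thesis by simp
  qed
  have mono_t: "strict_mono_on {1..t} i" using t by (intro monotone_on_subset[OF assms(2)]) auto
  have "{1..t} \<subseteq> {1..s}" using t by auto
  then have sub_t: "i ` {1..t} \<subseteq> {1..n}" using assms(3) by blast
  define c where "c = 1 + (real s - real \<nu>) / (real (i \<nu>) - real \<nu> + 1)"
  have bounds: "i t < s" "s \<le> i u" using assms(9) unfolding IT T0 by auto
  have \<nu>: "\<nu> = i t + 1" using assms(11) unfolding IT .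
  have le: "real (cover_degree n (borel_edges i t) q) + real q * c
      \<le> real (cover_degree n (borel_edges i s) q)" for q
    unfolding c_def using assms(2,3) t run bounds \<nu> by (rule cover_degree_borel_ge)
  let ?a = "\<lambda>t q. real (cover_degree n (borel_edges i t) q) / real q"
  have lim_s: "?a s \<longlonglongrightarrow> waldschmidt n (sfBorel n (sf_monomial i s) :: 'a mpolynomial set)"
    unfolding sfBorel_eq_edge_ideal[OF assms(3)]
    by (rule waldschmidt_edge_ideal_LIMSEQ[OF borel_edges_subset[OF assms(3)]
          borel_edges_nonempty[OF assms(2,3)]])
  have lim_t: "(\<lambda>q. ?a t q + c) \<longlonglongrightarrow> waldschmidt n (sfBorel n (sf_monomial i t) :: 'a mpolynomial set) + c"
    unfolding sfBorel_eq_edge_ideal[OF sub_t]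
    by (intro tendsto_add tendsto_const waldschmidt_edge_ideal_LIMSEQ[OF borel_edges_subset[OF sub_t]
          borel_edges_nonempty[OF mono_t sub_t]])
  have "?a t q + c \<le> ?a s q" if "1 \<le> q" for q
  proof -
    have "?a t q + c = (real (cover_degree n (borel_edges i t) q) + real q * c) / real q"
      using that by (simp add: add_divide_distrib)
    also have "\<dots> \<le> ?a s q" using le by (rule divide_right_mono) simp
    finally show ?thesis .
  qed
  then have "waldschmidt n (sfBorel n (sf_monomial i t) :: 'a mpolynomial set) + c
      \<le> waldschmidt n (sfBorel n (sf_monomial i s) :: 'a mpolynomial set)"
    using LIMSEQ_le[OF lim_t lim_s] by blast
  then show ?thesis unfolding assms(7) T0 t_def[symmetric] c_def by linarith
qed

end
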